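(* Let $\alpha>0$ and let $\Lambda\subseteq\mathbb{C}$ be a Liouville set for $\mathcal{F}_{4\alpha}(\mathbb{C})$. Let $f:\mathbb{C}\to[0,\infty)$ be given by $f(z)=e^{-\gamma|z|^2}$ with $\gamma>2\alpha$. Suppose that $A=(a_\lambda)_{\lambda\in\Lambda}$, $B=(b_\lambda)_{\lambda\in\Lambda}$, $C=(c_\lambda)_{\lambda\in\Lambda}\subseteq\mathbb{C}$ are $f$-close to $\Lambda$. If $$\exists\,\beta\in(0,\gamma-2\alpha),\ \exists\,L>0:\quad \frac{|\lambda|e^{-\beta|\lambda|^2}}{\varphi(a_\lambda,b_\lambda,c_\lambda)}\le L\quad\text{for all }\lambda\in\Lambda, \qquad ( * )$$ then $\mathcal{U}:=A\cup B\cup C$ is a uniqueness set for the phase retrieval problem in $\mathcal{F}_\alpha(\mathbb{C})$. In particular, condition $( * )$ holds if $A,B,C$ are uniformly noncollinear.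
   Context: For $\alpha>0$, $\mathcal{F}_\alpha(\mathbb{C})$ is the Fock space of entire functions $F:\mathbb{C}\to\mathbb{C}$ with $\int_{\mathbb{C}}|F(z)|^2e^{-\alpha|z|^2}\,dA(z)<\infty$, where $dA$ is Lebesgue area measure. A set $\Lambda\subseteq\mathbb{C}$ is a Liouville set for a set $V$ of entire functions if every $F\in V$ that is bounded on $\Lambda$ is a constant function. A set $\mathcal{U}\subseteq\mathbb{C}$ is a uniqueness set for the phase retrieval problem in $\mathcal{F}_\alpha(\mathbb{C})$ if for all $F,H\in\mathcal{F}_\alpha(\mathbb{C})$: whenever $|F(u)|=|H(u)|$ for all $u\in\mathcal{U}$, there is $\tau\in\mathbb{C}$ with $|\tau|=1$ and $H=\tau F$. A sequence $A=(a_\lambda)_{\lambda\in\Lambda}$ is $f$-close to $\Lambda$ if there is a constant $\kappa>0$ with $|a_\lambda-\lambda|\le\kappa f(\lambda)$ for all $\lambda\in\Lambda$. Sequences are identified with their sets of values when forming unions. For $a,b,c\in\mathbb{C}$ noncollinear, let $\varphi_1\le\varphi_2\le\varphi_3$ be the interior angles of the triangle with vertices $a,b,c$ and set $\varphi(a,b,c):=\varphi_2\in[0,\frac{\pi}{2}]$; if $a,b,c$ are collinear (degenerate triangle) set $\varphi(a,b,c):=0$. Condition $( * )$ is understood to include that $\varphi(a_\lambda,b_\lambda,c_\lambda)>0$ for all $\lambda\in\Lambda$, so that the quotient makes sense. $A,B,C$ are uniformly noncollinear if there is $\theta\in(0,\frac{\pi}{2})$ with $\theta\le\varphi(a_\lambda,b_\lambda,c_\lambda)$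 for all $\lambda\in\Lambda$. *)

theory Defs
  imports "HOL-Analysis.Analysis"
begin

definition fock_space :: "real \<Rightarrow> (complex \<Rightarrow> complex) set" where
  "fock_space \<alpha> =
     {F. F holomorphic_on UNIV \<and>
         integrable lborel (\<lambda>z::complex. (cmod (F z))\<^sup>2 * exp (- \<alpha> * (cmod z)\<^sup>2))}"

definition liouville_set :: "complex set \<Rightarrow> (complex \<Rightarrow> complex) set \<Rightarrow> bool" where
  "liouville_set \<Lambda> V \<longleftrightarrow> (\<forall>F\<in>V. bounded (F ` \<Lambda>) \<longrightarrow> F constant_on UNIV)"

definition phase_retrieval_uniqueness_set ::
    "complex set \<Rightarrow> (complex \<Rightarrow> complex) set \<Rightarrow> bool" where
  "phase_retrieval_uniqueness_set U V \<longleftrightarrow>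
     (\<forall>F\<in>V. \<forall>H\<in>V. (\<forall>u\<in>U. cmod (F u) = cmod (H u)) \<longrightarrow>
        (\<exists>\<tau>. cmod \<tau> = 1 \<and> (\<forall>z. H z = \<tau> * F z)))"

text \<open>Families indexed by \<open>\<Lambda>\<close> are total functions on \<open>\<complex>\<close> of which only the
  values on \<open>\<Lambda>\<close> matter; the corresponding sets of values are \<open>a ` \<Lambda>\<close>.\<close>

definition f_close ::
    "(complex \<Rightarrow> real) \<Rightarrow> complex set \<Rightarrow> (complex \<Rightarrow> complex) \<Rightarrow> bool" where
  "f_close f \<Lambda> a \<longleftrightarrow> (\<exists>\<kappa>>0. \<forall>l\<in>\<Lambda>. cmod (a l - l) \<le> \<kappa> * f l)"

text \<open>The angle at \<open>v\<close> between the rays through \<open>p\<close> and \<open>q\<close>; it is only used when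
  \<open>p\<close>, \<open>v\<close>, \<open>q\<close> are noncollinear, so that the denominator does not vanish.\<close>

definition interior_angle :: "complex \<Rightarrow> complex \<Rightarrow> complex \<Rightarrow> real" where
  "interior_angle p v q =
     arccos (((p - v) \<bullet> (q - v)) / (cmod (p - v) * cmod (q - v)))"

text \<open>The second smallest interior angle, counted with multiplicity.\<close>

definition middle_angle :: "complex \<Rightarrow> complex \<Rightarrow> complex \<Rightarrow> real" where
  "middle_angle a b c =
     (if collinear {a, b, c} then 0
      else sort [interior_angle b a c, interior_angle a b c, interior_angle a c b] ! 1)"

definition uniformly_noncollinear ::
    "complex set \<Rightarrow> (complex \<Rightarrow> complex) \<Rightarrow> (complex \<Rightarrow> complex) \<Rightarrow> (complex \<Rightarrow> complex) \<Rightarrow> bool"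
  where
  "uniformly_noncollinear \<Lambda> a b c \<longleftrightarrow>
     (\<exists>\<theta>. 0 < \<theta> \<and> \<theta> < pi / 2 \<and> (\<forall>l\<in>\<Lambda>. \<theta> \<le> middle_angle (a l) (b l) (c l)))"

text \<open>Positivity of the angle is stated separately because
  \<open>x / 0 = 0\<close> would otherwise make the bound hold for collinear triples.\<close>

definition angle_condition ::
    "real \<Rightarrow> real \<Rightarrow> complex set \<Rightarrow>
     (complex \<Rightarrow> complex) \<Rightarrow> (complex \<Rightarrow> complex) \<Rightarrow> (complex \<Rightarrow> complex) \<Rightarrow> bool" where
  "angle_condition \<alpha> \<gamma> \<Lambda> a b c \<longleftrightarrow>
     (\<exists>\<beta>. 0 < \<beta> \<and> \<beta> < \<gamma> - 2 * \<alpha> \<and>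
        (\<exists>L>0. \<forall>l\<in>\<Lambda>. 0 < middle_angle (a l) (b l) (c l) \<and>
           cmod l * exp (- \<beta> * (cmod l)\<^sup>2) / middle_angle (a l) (b l) (c l) \<le> L))"

end

theory Submission
  imports Defs "HOL-Complex_Analysis.Complex_Analysis" "HOL-Probability.Distributions"
begin

text \<open>
  Let \<open>F\<close> and \<open>H\<close> belong to the Fock space with parameter \<open>\<alpha>\<close>, let \<open>|F| = |H|\<close> on
  \<open>A \<union> B \<union> C\<close>, and let \<open>W = F' H - F H'\<close>. It suffices to show \<open>W = 0\<close>: then \<open>H / F\<close> has
  derivative zero, so \<open>H = \<tau> F\<close>, and \<open>|\<tau>| = 1\<close> because \<open>F\<close> cannot vanish on all of
  \<open>A \<union> B \<union> C\<close> without vanishing identically; if it does, then so does \<open>H\<close>, for the same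
  reason.

  The function \<open>|F|\<^sup>2 - |H|\<^sup>2\<close> vanishes at three points that lie extremely close to each
  \<open>\<lambda> \<in> \<Lambda>\<close>. If these were collinear, only one directional derivative would be forced to be small;
  since they span a triangle, two directional derivatives at one vertex \<open>p\<close> are small, and with
  them the whole Wirtinger derivative \<open>g = F' cnj F - H' cnj H\<close>, at the price of a factor
  \<open>1 / \<phi>\<close>, where \<open>\<phi>\<close> is the angle at \<open>p\<close>. Taking for \<open>p\<close> the vertex of the middle angle
  gives \<open>\<phi> \<le> \<pi>/2\<close>, hence \<open>sin \<phi> \<ge> \<phi>/2\<close>. As \<open>|F p| = |H p|\<close>, we have
  \<open>cnj (F p) * W p = H p * g\<close>, so the entire function \<open>F W\<close> is small at \<open>p\<close>
  (\<open>wronskian_product_local_bound\<close>), and therefore bounded at \<open>\<lambda>\<close>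
  (\<open>wronskian_product_bounded\<close>).

  All estimates are phrased in terms of the growth \<open>O(exp((s + \<epsilon>)|z|\<^sup>2))\<close> for every \<open>\<epsilon> > 0\<close>.
  Elements of the Fock space with parameter \<open>\<alpha>\<close> satisfy it with \<open>s = \<alpha>/2\<close>
  (\<open>quadratic_type_le_if_fock_space\<close>), a product of three of them with \<open>s = 3\<alpha>/2\<close>, derivatives cost
  nothing, and \<open>2 s < 4 \<alpha>\<close> brings the product back into the Fock space with parameter \<open>4 \<alpha>\<close>
  (\<open>fock_space_if_quadratic_type_le\<close>). The estimate for \<open>F W\<close> involves
  \<open>exp((3\<alpha>/2 + 3\<epsilon> - \<gamma> + \<beta>)|\<lambda>|\<^sup>2)\<close>, and \<open>\<beta> < \<gamma> - 2\<alpha>\<close> leaves \<open>\<alpha>/2\<close> to absorb \<open>3\<epsilon>\<close>.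

  By the Liouville property, \<open>F W\<close> and, by symmetry, \<open>H W\<close> are constant. If \<open>F W\<close> were a nonzero
  constant, \<open>H\<close> would be a multiple of \<open>F\<close> and \<open>W\<close> would vanish after all; so \<open>F W = 0\<close>, which
  forces \<open>W = 0\<close>.
\<close>

section \<open>Lebesgue measure on the complex plane and a mean value inequality\<close>

lemma continuous_Complex_pair: "continuous_on S (\<lambda>(x, y). Complex x y)"
  unfolding Complex_eq case_prod_beta by (intro continuous_intros)

text \<open>This makes area integrals accessible to iterated integration in the real and imaginary
  part.\<close>
lemma lborel_complex_eq_distr:
  "(lborel :: complex measure) = distr lborel borel (\<lambda>(x, y). Complex x y)"
proof (rule lborel_eqI)
  have meas: "(\<lambda>(x, y). Complex x y) \<in> borel_measurable (lborel :: (real \<times> real) measure)"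
    using continuous_Complex_pair[of UNIV] by (simp add: borel_measurable_continuous_onI)
  fix l u :: complex
  assume le: "\<And>b. b \<in> Basis \<Longrightarrow> l \<bullet> b \<le> u \<bullet> b"
  have le': "Re l \<le> Re u" "Im l \<le> Im u"
    using le[of 1] le[of \<i>] by (auto simp: Basis_complex_def)
  have "(\<lambda>(x, y). Complex x y) -` box l u = box (Re l, Im l) (Re u, Im u)"
    by (auto simp: in_box_complex_iff mem_box Basis_prod_def)
  moreover have "emeasure lborel (box (Re l, Im l) (Re u, Im u)) = (Re u - Re l) * (Im u - Im l)"
  proof -
    have "\<And>b. b \<in> Basis \<Longrightarrow> (Re l, Im l) \<bullet> b \<le> (Re u, Im u) \<bullet> b"
      using le' by (auto simp: Basis_prod_def)
    moreover have "(\<Prod>b\<in>Basis. ((Re u, Im u) - (Re l, Im l)) \<bullet> b) = (Re u - Re l) * (Im u - Im l)"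
      by (simp add: Basis_prod_def)
    ultimately show ?thesis
      by (simp only: emeasure_lborel_box)
  qed
  ultimately show "emeasure (distr lborel borel (\<lambda>(x, y). Complex x y)) (box l u) =
      (\<Prod>b\<in>Basis. (u - l) \<bullet> b)"
    by (simp add: emeasure_distr[OF meas] Basis_complex_def)
qed simp

lemma integrable_gaussian_complex:
  assumes "c > 0"
  shows "integrable lborel (\<lambda>z::complex. exp (- c * (cmod z)\<^sup>2))"
proof -
  define \<sigma> where "\<sigma> = sqrt (1 / (2 * c))"
  have \<sigma>: "\<sigma> > 0" "2 * \<sigma>\<^sup>2 = 1 / c"
    using assms by (auto simp: \<sigma>_def)
  have "integrable lborel (\<lambda>x. sqrt (2 * pi * \<sigma>\<^sup>2) * normal_density 0 \<sigma> x)"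
    using \<sigma>(1) by (intro integrable_mult_right integrable_normal_density)
  also have "(\<lambda>x. sqrt (2 * pi * \<sigma>\<^sup>2) * normal_density 0 \<sigma> x) = (\<lambda>x. exp (- c * x\<^sup>2))"
    using \<sigma> assms by (auto simp: normal_density_def fun_eq_iff)
  finally have int: "integrable lborel (\<lambda>x::real. exp (- c * x\<^sup>2))" .
  hence fin: "(\<integral>\<^sup>+(x::real). ennreal (exp (- c * x\<^sup>2)) \<partial>lborel) < \<infinity>"
    by (simp add: integrable_iff_bounded)
  have "(\<integral>\<^sup>+(z::complex). ennreal (exp (- c * (cmod z)\<^sup>2)) \<partial>lborel)
      = (\<integral>\<^sup>+(z::complex). (\<Prod>b\<in>Basis. ennreal (exp (- c * (z \<bullet> b)\<^sup>2))) \<partial>lborel)"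
    by (intro nn_integral_cong)
       (simp add: Basis_complex_def cmod_power2 algebra_simps flip: exp_add ennreal_mult)
  also have "\<dots> = (\<Prod>b\<in>(Basis :: complex set). (\<integral>\<^sup>+(x::real). ennreal (exp (- c * x\<^sup>2)) \<partial>lborel))"
    by (rule nn_integral_lborel_prod) auto
  also have "\<dots> < \<infinity>"
    using fin by (simp add: Basis_complex_def ennreal_mult_less_top)
  finally show ?thesis
    by (intro integrableI_bounded) auto
qed

text \<open>Multiplication by \<open>\<i>\<close> turns a horizontal segment into a vertical one, for which the
  formula is \<open>contour_integral_linepath_same_Re\<close>.\<close>
lemma contour_integral_linepath_same_Im:
  assumes "a < b"
  shows "contour_integral (linepath (Complex a c) (Complex b c)) f =
           integral {a..b} (\<lambda>x. f (Complex x c))"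
proof -
  have rot: "\<i> * Complex x c = Complex (- c) x" "- (\<i> * Complex (- c) x) = Complex x c" for x
    by (simp_all add: complex_eq_iff)
  have lin: "linepath (Complex (- c) a) (Complex (- c) b) x = \<i> * linepath (Complex a c) (Complex b c) x" for x
    by (simp add: linepath_def complex_eq_iff algebra_simps)
  have dir: "\<i> * (Complex b c - Complex a c) = Complex (- c) b - Complex (- c) a"
    by (simp add: complex_eq_iff)
  have "\<i> * integral {a..b} (\<lambda>x. f (- (\<i> * Complex (- c) x))) =
      contour_integral (linepath (Complex (- c) a) (Complex (- c) b)) (\<lambda>w. f (- (\<i> * w)))"
    by (rule contour_integral_linepath_same_Re[symmetric]) (use assms in auto)
  also have "\<dots> = (\<i> * (Complex b c - Complex a c)) *
      integral {0..1} (\<lambda>x. f (linepath (Complex a c) (Complex b c) x))"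
    unfolding dir by (simp add: contour_integral_integral lin flip: mult.assoc)
  also have "\<dots> = \<i> * contour_integral (linepath (Complex a c) (Complex b c)) f"
    by (simp add: contour_integral_integral mult_ac)
  finally show ?thesis
    by (simp add: rot)
qed

text \<open>Cauchy's formula on the boundary of the square with centre \<open>z\<close> and half side \<open>s\<close> bounds
  \<open>|h z|\<close> by integrals of \<open>|h|\<close> over the four sides, on which \<open>|w - z| \<ge> s \<ge> 1\<close>. Averaging over
  \<open>s \<in> [1, 2]\<close> turns the line integrals into area integrals; the two horizontal sides sweep out
  disjoint parts of the large square, and so do the two vertical sides. Squares take the place of
  the usual discs because Cartesian iterated integrals then suffice.\<close>
lemma square_mean_bound:
  assumes h: "h holomorphic_on UNIV"
  shows "pi * cmod (h z) \<le> 
     integral (cbox (Re z - 2, Im z - 2) (Re z + 2, Im z + 2)) (\<lambda>(u, v). cmod (h (Complex u v)))"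
proof -
  define x y where "x = Re z" and "y = Im z"
  define g where "g u v = cmod (h (Complex u v))" for u v
  have hc: "continuous_on S h" for S
    using h holomorphic_on_imp_continuous_on holomorphic_on_subset by blast
  have gc: "continuous_on S (\<lambda>(u, v). g u v)" for S
    unfolding g_def case_prod_beta Complex_eq
    by (intro continuous_intros continuous_on_compose2[OF hc[of UNIV]]) auto
  have gc1: "continuous_on S (\<lambda>u. g u v)" and gc2: "continuous_on S (\<lambda>v. g u v)" for S u v
    unfolding g_def Complex_eq
    by (intro continuous_intros continuous_on_compose2[OF hc[of UNIV]]; simp)+
  define J where "J v = integral {x - 2..x + 2} (\<lambda>u. g u v)" for v
  define K where "K u = integral {y - 2..y + 2} (\<lambda>v. g u v)" for u
  have Jc: "continuous_on {y - 2..y + 2} J"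
  proof -
    have "continuous_on (cbox (y - 2) (y + 2)) (\<lambda>v. integral (cbox (x - 2) (x + 2)) (\<lambda>u. g u v))"
      by (rule integral_continuous_on_param) (use gc1 gc in \<open>auto simp: case_prod_beta g_def Complex_eq intro!: continuous_intros continuous_on_compose2[OF hc[of UNIV]]\<close>)
    thus ?thesis by (simp add: J_def[abs_def])
  qed
  have Kc: "continuous_on {x - 2..x + 2} K"
  proof -
    have "continuous_on (cbox (x - 2) (x + 2)) (\<lambda>u. integral (cbox (y - 2) (y + 2)) (\<lambda>v. g u v))"
      by (rule integral_continuous_on_param) (use gc in \<open>auto simp: case_prod_beta g_def Complex_eq intro!: continuous_intros continuous_on_compose2[OF hc[of UNIV]]\<close>)
    thus ?thesis by (simp add: K_def[abs_def])
  qed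
  have main: "2 * pi * cmod (h z) \<le> J (y + s) + J (y - s) + K (x + s) + K (x - s)"
    if s: "1 \<le> s" "s \<le> 2" for s
  proof -
    let ?p = "rectpath (Complex (x - s) (y - s)) (Complex (x + s) (y + s))"
    let ?f = "\<lambda>w. h w / (w - z)"
    have img: "path_image ?p = {w. Re w \<in> {x - s, x + s} \<and> Im w \<in> {y - s..y + s}} \<union>
           {w. Im w \<in> {y - s, y + s} \<and> Re w \<in> {x - s..x + s}}"
      using s by (subst path_image_rectpath) auto
    have zbox: "z \<in> box (Complex (x - s) (y - s)) (Complex (x + s) (y + s))"
      using s by (auto simp: in_box_complex_iff x_def y_def)
    have nz: "z \<notin> path_image ?p"
      using zbox path_image_rectpath_inter_box[of "Complex (x - s) (y - s)" "Complex (x + s) (y + s)"] s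
      by auto
    have far: "1 \<le> cmod (w - z)" if "w \<in> path_image ?p" for w
    proof -
      have "1 \<le> \<bar>Re (w - z)\<bar> \<or> 1 \<le> \<bar>Im (w - z)\<bar>"
        using that s unfolding img by (auto simp: x_def y_def)
      thus ?thesis
        using abs_Re_le_cmod[of "w - z"] abs_Im_le_cmod[of "w - z"] by linarith
    qed
    have sidesub: "closed_segment (Complex (x - s) (y - s)) (Complex (x + s) (y - s)) \<subseteq> path_image ?p"
      "closed_segment (Complex (x + s) (y - s)) (Complex (x + s) (y + s)) \<subseteq> path_image ?p"
      "closed_segment (Complex (x + s) (y + s)) (Complex (x - s) (y + s)) \<subseteq> path_image ?p"
      "closed_segment (Complex (x - s) (y + s)) (Complex (x - s) (y - s)) \<subseteq> path_image ?p"
      by (auto simp: rectpath_def Let_def path_image_join)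
    have fc: "continuous_on (path_image ?p) ?f"
      using far by (intro continuous_intros hc) force
    have sideint: "?f contour_integrable_on linepath a b" if "closed_segment a b \<subseteq> path_image ?p" for a b
      using continuous_on_subset[OF fc that] by (rule contour_integrable_continuous_linepath)
    have fle: "cmod (?f w) \<le> cmod (h w)" if "w \<in> path_image ?p" for w
      using frac_le[OF norm_ge_zero order_refl zero_less_one far[OF that], of "h w"] by (simp add: norm_divide)
    \<comment> \<open>Enlarging the sides to length 4 makes the bounds independent of \<open>s\<close>.\<close>
    have hor: "cmod (integral {x - s..x + s} (\<lambda>u. ?f (Complex u v))) \<le> J v"
      if v: "v = y - s \<or> v = y + s" for v
    proof -
      have sub: "Complex u v \<in> path_image ?p" if "u \<in> {x - s..x + s}" for u
        using that v unfolding img by auto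
      have "cmod (integral {x - s..x + s} (\<lambda>u. ?f (Complex u v))) \<le> integral {x - s..x + s} (\<lambda>u. g u v)"
      proof (rule integral_norm_bound_integral)
        have "continuous_on {x - s..x + s} (\<lambda>u. ?f (Complex u v))"
          by (rule continuous_on_compose2[OF fc]) (use sub in \<open>auto simp: Complex_eq intro!: continuous_intros\<close>)
        thus "(\<lambda>u. ?f (Complex u v)) integrable_on {x - s..x + s}"
          by (rule integrable_continuous_interval)
        show "(\<lambda>u. g u v) integrable_on {x - s..x + s}"
          by (rule integrable_continuous_interval[OF gc1])
        show "cmod (?f (Complex u v)) \<le> g u v" if "u \<in> {x - s..x + s}" for u
          unfolding g_def by (rule fle[OF sub[OF that]])
      qed
      also have "\<dots> \<le> J v"
        unfolding J_def using s
        by (intro integral_subset_le integrable_continuous_interval gc1) (auto simp: g_def)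
      finally show ?thesis .
    qed
    have ver: "cmod (integral {y - s..y + s} (\<lambda>v. ?f (Complex u v))) \<le> K u"
      if u: "u = x - s \<or> u = x + s" for u
    proof -
      have sub: "Complex u v \<in> path_image ?p" if "v \<in> {y - s..y + s}" for v
        using that u unfolding img by auto
      have "cmod (integral {y - s..y + s} (\<lambda>v. ?f (Complex u v))) \<le> integral {y - s..y + s} (\<lambda>v. g u v)"
      proof (rule integral_norm_bound_integral)
        have "continuous_on {y - s..y + s} (\<lambda>v. ?f (Complex u v))"
          by (rule continuous_on_compose2[OF fc]) (use sub in \<open>auto simp: Complex_eq intro!: continuous_intros\<close>)
        thus "(\<lambda>v. ?f (Complex u v)) integrable_on {y - s..y + s}"
          by (rule integrable_continuous_interval)
        show "(\<lambda>v. g u v) integrable_on {y - s..y + s}"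
          by (rule integrable_continuous_interval[OF gc2])
        show "cmod (?f (Complex u v)) \<le> g u v" if "v \<in> {y - s..y + s}" for v
          unfolding g_def by (rule fle[OF sub[OF that]])
      qed
      also have "\<dots> \<le> K u"
        unfolding K_def using s
        by (intro integral_subset_le integrable_continuous_interval gc2) (auto simp: g_def)
      finally show ?thesis .
    qed
    have "(?f has_contour_integral (2 * pi * \<i> * winding_number ?p z * h z)) ?p"
      using nz by (intro Cauchy_integral_formula_convex_simple[where S = UNIV] h) auto
    moreover have "winding_number ?p z = 1"
      using zbox by (rule winding_number_rectpath)
    ultimately have "contour_integral ?p ?f = 2 * pi * \<i> * h z"
      by (simp add: contour_integral_unique)
    also have "contour_integral ?p ?f =
        contour_integral (linepath (Complex (x - s) (y - s)) (Complex (x + s) (y - s))) ?f +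
        (contour_integral (linepath (Complex (x + s) (y - s)) (Complex (x + s) (y + s))) ?f +
        (contour_integral (linepath (Complex (x + s) (y + s)) (Complex (x - s) (y + s))) ?f +
         contour_integral (linepath (Complex (x - s) (y + s)) (Complex (x - s) (y - s))) ?f))"
      unfolding rectpath_def Let_def using sidesub[THEN sideint] by simp
    also have "contour_integral (linepath (Complex (x + s) (y + s)) (Complex (x - s) (y + s))) ?f =
        - contour_integral (linepath (Complex (x - s) (y + s)) (Complex (x + s) (y + s))) ?f"
      using continuous_on_subset[OF fc sidesub(3)] by (rule contour_integral_reverse_linepath)
    also have "contour_integral (linepath (Complex (x - s) (y + s)) (Complex (x - s) (y - s))) ?f =
        - contour_integral (linepath (Complex (x - s) (y - s)) (Complex (x - s) (y + s))) ?f"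
      using continuous_on_subset[OF fc sidesub(4)] by (rule contour_integral_reverse_linepath)
    finally have eq: "2 * pi * \<i> * h z = 
        integral {x - s..x + s} (\<lambda>u. ?f (Complex u (y - s))) +
        (\<i> * integral {y - s..y + s} (\<lambda>v. ?f (Complex (x + s) v)) +
         (- integral {x - s..x + s} (\<lambda>u. ?f (Complex u (y + s))) +
          - (\<i> * integral {y - s..y + s} (\<lambda>v. ?f (Complex (x - s) v)))))"
      (is "_ = ?I1 + (\<i> * ?I2 + (- ?I3 + - (\<i> * ?I4)))")
      using s by (simp add: contour_integral_linepath_same_Re[where a = "y - s" and b = "y + s"]
        contour_integral_linepath_same_Im)
    have "2 * pi * cmod (h z) = cmod (2 * pi * \<i> * h z)"
      by (simp add: norm_mult)
    also have "\<dots> \<le> cmod ?I1 + (cmod (\<i> * ?I2) + (cmod (- ?I3) + cmod (- (\<i> * ?I4))))"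
      unfolding eq by (intro norm_triangle_le add_left_mono order_refl)
    also have "\<dots> \<le> J (y - s) + (K (x + s) + (J (y + s) + K (x - s)))"
      unfolding norm_minus_cancel norm_mult norm_ii mult_1
      by (intro add_mono hor ver) auto
    finally show ?thesis by simp
  qed
  let ?T = "integral (cbox (x - 2, y - 2) (x + 2, y + 2)) (\<lambda>(u, v). g u v)"
  have TK: "?T = integral {x - 2..x + 2} K"
    using integral_prod_continuous[OF gc, of "x - 2" "y - 2" "x + 2" "y + 2"] by (simp add: K_def[abs_def])
  have TJ: "?T = integral {y - 2..y + 2} J"
    using integral_swap_continuous[OF gc, of "x - 2" "x + 2" "y - 2" "y + 2"] TK
    by (simp add: K_def[abs_def] J_def[abs_def])
  \<comment> \<open>As \<open>s\<close> runs through \<open>[1, 2]\<close>, the points \<open>c + s\<close> and \<open>c - s\<close> cover the two outer quarters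
    of \<open>[c - 2, c + 2]\<close>.\<close>
  have halves: "integral {1..2} (\<lambda>s. P (c + s)) + integral {1..2} (\<lambda>s. P (c - s)) \<le> integral {c - 2..c + 2} P
      \<and> (\<lambda>s. P (c + s)) integrable_on {1..2} \<and> (\<lambda>s. P (c - s)) integrable_on {1..2}"
    if P: "continuous_on {c - 2..c + 2} P" "\<And>t. 0 \<le> P t" for P :: "real \<Rightarrow> real" and c
  proof -
    have i: "P integrable_on {c - 2..c + 2}"
      using P(1) by (rule integrable_continuous_interval)
    have sub: "P integrable_on {a..b}" if "{a..b} \<subseteq> {c - 2..c + 2}" for a b
      using integrable_on_subinterval[OF i that] .
    have "((\<lambda>s. P (c + s)) has_integral integral {c + 1..c + 2} P) {1..2}"
      using has_integral_shift_real_ivl[OF integrable_integral[OF sub[of "c + 1" "c + 2"]], of c]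
      by (simp add: add.commute)
    moreover have "((\<lambda>s. P (c - s)) has_integral integral {c - 2..c - 1} P) {1..2}"
      using has_integral_reflect_lemma_real
        [OF has_integral_shift_real_ivl[OF integrable_integral[OF sub[of "c - 2" "c - 1"]], of c]]
      by simp
    moreover have "integral {c - 2..c - 1} P + integral {c - 1..c + 1} P = integral {c - 2..c + 1} P"
      by (intro Henstock_Kurzweil_Integration.integral_combine sub) auto
    moreover have "integral {c - 2..c + 1} P + integral {c + 1..c + 2} P = integral {c - 2..c + 2} P"
      by (intro Henstock_Kurzweil_Integration.integral_combine sub) auto
    moreover have "0 \<le> integral {c - 1..c + 1} P"
      by (intro integral_nonneg sub) (auto simp: P)
    ultimately show ?thesis
      by (auto simp: integral_unique has_integral_integrable)
  qed
  have nonneg: "0 \<le> J t" "0 \<le> K t" for t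
    unfolding J_def K_def
    by (intro integral_nonneg integrable_continuous_interval gc1 gc2; simp add: g_def)+
  note HJ = halves[OF Jc nonneg(1)] and HK = halves[OF Kc nonneg(2)]
  have "2 * pi * cmod (h z) = integral {1..2::real} (\<lambda>s. 2 * pi * cmod (h z))"
    by simp
  also have "\<dots> \<le> integral {1..2} (\<lambda>s. J (y + s) + J (y - s) + K (x + s) + K (x - s))"
    using HJ HK by (intro integral_le integrable_add main) auto
  also have "\<dots> = (integral {1..2} (\<lambda>s. J (y + s)) + integral {1..2} (\<lambda>s. J (y - s))) +
      (integral {1..2} (\<lambda>s. K (x + s)) + integral {1..2} (\<lambda>s. K (x - s)))"
    using HJ HK by (simp add: Henstock_Kurzweil_Integration.integral_add integrable_add)
  also have "\<dots> \<le> ?T + ?T"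
    using HJ HK TK TJ by (metis add_mono)
  finally show ?thesis
    by (simp add: x_def y_def g_def)
qed

section \<open>Growth of Fock space functions\<close>

text \<open>Growth of order two and type at most \<open>s\<close>. The arbitrary loss \<open>\<epsilon>\<close> makes the notion stable
  under differentiation and bounded translations, so that polynomial factors need no
  bookkeeping.\<close>
definition quadratic_type_le :: "real \<Rightarrow> (complex \<Rightarrow> complex) \<Rightarrow> bool" where
  "quadratic_type_le s F \<longleftrightarrow>
     (\<forall>\<epsilon>>0. \<exists>C>0. \<forall>z. cmod (F z) \<le> C * exp ((s + \<epsilon>) * (cmod z)\<^sup>2))"

text \<open>The cross term \<open>2 t K r\<close> is split by \<open>0 \<le> (\<epsilon> r - t K)\<^sup>2 / \<epsilon>\<close>.\<close>
lemma exp_square_shift: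
  fixes t \<epsilon> K :: real
  assumes "0 \<le> t" "0 < \<epsilon>" "0 \<le> K"
  shows "\<exists>C>0. \<forall>r\<ge>0. exp (t * (r + K)\<^sup>2) \<le> C * exp ((t + \<epsilon>) * r\<^sup>2)"
proof (intro exI[of _ "exp ((t + t\<^sup>2 / \<epsilon>) * K\<^sup>2)"] conjI allI impI)
  fix r :: real assume "0 \<le> r"
  have "0 \<le> (\<epsilon> * r - t * K)\<^sup>2 / \<epsilon>"
    using assms by simp
  hence "t * (r + K)\<^sup>2 \<le> (t + t\<^sup>2 / \<epsilon>) * K\<^sup>2 + (t + \<epsilon>) * r\<^sup>2"
    using assms by (simp add: field_simps power2_eq_square)
  thus "exp (t * (r + K)\<^sup>2) \<le> exp ((t + t\<^sup>2 / \<epsilon>) * K\<^sup>2) * exp ((t + \<epsilon>) * r\<^sup>2)"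
    by (simp flip: exp_add)
qed simp

lemma quadratic_type_le_cball:
  assumes "quadratic_type_le s F" "0 \<le> s" "0 < \<epsilon>" "0 \<le> K"
  shows "\<exists>C>0. \<forall>z. \<forall>w\<in>cball z K. cmod (F w) \<le> C * exp ((s + \<epsilon>) * (cmod z)\<^sup>2)"
proof -
  obtain C where C: "C > 0" "\<And>z. cmod (F z) \<le> C * exp ((s + \<epsilon> / 2) * (cmod z)\<^sup>2)"
    using assms unfolding quadratic_type_le_def by (meson half_gt_zero)
  obtain D where D: "D > 0" "\<And>r. r \<ge> 0 \<Longrightarrow>
      exp ((s + \<epsilon> / 2) * (r + K)\<^sup>2) \<le> D * exp ((s + \<epsilon> / 2 + \<epsilon> / 2) * r\<^sup>2)"
    using exp_square_shift[of "s + \<epsilon> / 2" "\<epsilon> / 2" K] assms by auto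
  have "cmod (F w) \<le> C * D * exp ((s + \<epsilon>) * (cmod z)\<^sup>2)" if "w \<in> cball z K" for z w
  proof -
    have "cmod w \<le> cmod z + K"
      using that norm_triangle_ineq[of z "w - z"] by (simp add: dist_norm norm_minus_commute)
    hence "(s + \<epsilon> / 2) * (cmod w)\<^sup>2 \<le> (s + \<epsilon> / 2) * (cmod z + K)\<^sup>2"
      using assms by (intro mult_left_mono power_mono) auto
    hence "cmod (F w) \<le> C * exp ((s + \<epsilon> / 2) * (cmod z + K)\<^sup>2)"
      using C by (meson exp_le_cancel_iff mult_left_mono less_imp_le order_trans)
    also have "\<dots> \<le> C * (D * exp ((s + \<epsilon> / 2 + \<epsilon> / 2) * (cmod z)\<^sup>2))"
      using C(1) D(2)[of "cmod z"] by (intro mult_left_mono) auto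
    finally show ?thesis by (simp add: mult_ac add_ac)
  qed
  thus ?thesis using C(1) D(1) by (intro exI[of _ "C * D"]) auto
qed

lemma quadratic_type_le_mult:
  assumes "quadratic_type_le s F" "quadratic_type_le t G"
  shows "quadratic_type_le (s + t) (\<lambda>z. F z * G z)"
  unfolding quadratic_type_le_def
proof (intro allI impI)
  fix \<epsilon> :: real assume "0 < \<epsilon>"
  then obtain C D where C: "C > 0" "\<And>z. cmod (F z) \<le> C * exp ((s + \<epsilon> / 2) * (cmod z)\<^sup>2)"
    and D: "D > 0" "\<And>z. cmod (G z) \<le> D * exp ((t + \<epsilon> / 2) * (cmod z)\<^sup>2)"
    using assms unfolding quadratic_type_le_def by (meson half_gt_zero)
  have "cmod (F z * G z) \<le> (C * D) * exp ((s + t + \<epsilon>) * (cmod z)\<^sup>2)" for z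
  proof -
    have "cmod (F z) * cmod (G z) \<le>
        (C * exp ((s + \<epsilon> / 2) * (cmod z)\<^sup>2)) * (D * exp ((t + \<epsilon> / 2) * (cmod z)\<^sup>2))"
      using C D by (intro mult_mono) auto
    also have "\<dots> = (C * D) * exp ((s + t + \<epsilon>) * (cmod z)\<^sup>2)"
      by (simp add: algebra_simps flip: exp_add)
    finally show ?thesis by (simp add: norm_mult)
  qed
  thus "\<exists>C>0. \<forall>z. cmod (F z * G z) \<le> C * exp ((s + t + \<epsilon>) * (cmod z)\<^sup>2)"
    using C(1) D(1) by (intro exI[of _ "C * D"]) auto
qed

lemma quadratic_type_le_diff:
  assumes "quadratic_type_le s F" "quadratic_type_le s G"
  shows "quadratic_type_le s (\<lambda>z. F z - G z)"
  unfolding quadratic_type_le_def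
proof (intro allI impI)
  fix \<epsilon> :: real assume "0 < \<epsilon>"
  then obtain C D where C: "C > 0" "\<And>z. cmod (F z) \<le> C * exp ((s + \<epsilon>) * (cmod z)\<^sup>2)"
    and D: "D > 0" "\<And>z. cmod (G z) \<le> D * exp ((s + \<epsilon>) * (cmod z)\<^sup>2)"
    using assms unfolding quadratic_type_le_def by meson
  have "cmod (F z - G z) \<le> (C + D) * exp ((s + \<epsilon>) * (cmod z)\<^sup>2)" for z
    using norm_triangle_ineq4[of "F z" "G z"] C(2)[of z] D(2)[of z] by (simp add: algebra_simps)
  thus "\<exists>C>0. \<forall>z. cmod (F z - G z) \<le> C * exp ((s + \<epsilon>) * (cmod z)\<^sup>2)"
    using C(1) D(1) by (intro exI[of _ "C + D"]) auto
qed

text \<open>Cauchy's estimate on discs of radius one.\<close>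
lemma quadratic_type_le_deriv:
  assumes "quadratic_type_le s F" "0 \<le> s" "F holomorphic_on UNIV"
  shows "quadratic_type_le s (deriv F)"
  unfolding quadratic_type_le_def
proof (intro allI impI)
  fix \<epsilon> :: real assume "0 < \<epsilon>"
  then obtain C where C: "C > 0"
      "\<And>z w. w \<in> cball z 1 \<Longrightarrow> cmod (F w) \<le> C * exp ((s + \<epsilon>) * (cmod z)\<^sup>2)"
    using quadratic_type_le_cball[OF assms(1,2), of \<epsilon> 1] by auto
  have "cmod (deriv F z) \<le> C * exp ((s + \<epsilon>) * (cmod z)\<^sup>2)" for z
  proof -
    have "cmod ((deriv ^^ 1) F z) \<le> fact 1 * (C * exp ((s + \<epsilon>) * (cmod z)\<^sup>2)) / 1 ^ 1"
    proof (rule Cauchy_inequality)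
      show "F holomorphic_on ball z 1" "continuous_on (cball z 1) F"
        using assms(3) holomorphic_on_imp_continuous_on holomorphic_on_subset by blast+
    qed (use C(2) in \<open>auto simp: dist_norm\<close>)
    thus ?thesis by simp
  qed
  thus "\<exists>C>0. \<forall>z. cmod (deriv F z) \<le> C * exp ((s + \<epsilon>) * (cmod z)\<^sup>2)"
    using C(1) by auto
qed

text \<open>The gap \<open>\<alpha> - 2 s\<close> pays for the loss \<open>\<epsilon>\<close> and leaves an integrable Gaussian.\<close>
lemma fock_space_if_quadratic_type_le:
  assumes "F holomorphic_on UNIV" "quadratic_type_le s F" "2 * s < \<alpha>"
  shows "F \<in> fock_space \<alpha>"
proof -
  define \<epsilon> where "\<epsilon> = (\<alpha> - 2 * s) / 4"
  have "\<epsilon> > 0" using assms(3) by (simp add: \<epsilon>_def)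
  then obtain C where C: "C > 0" "\<And>z. cmod (F z) \<le> C * exp ((s + \<epsilon>) * (cmod z)\<^sup>2)"
    using assms(2) unfolding quadratic_type_le_def by meson
  have hc: "continuous_on UNIV F"
    using assms(1) by (rule holomorphic_on_imp_continuous_on)
  have "integrable lborel (\<lambda>z::complex. (cmod (F z))\<^sup>2 * exp (- \<alpha> * (cmod z)\<^sup>2))"
  proof (rule Bochner_Integration.integrable_bound)
    show "integrable lborel (\<lambda>z::complex. C\<^sup>2 * exp (- (2 * \<epsilon>) * (cmod z)\<^sup>2))"
      using \<open>\<epsilon> > 0\<close> by (intro integrable_mult_right integrable_gaussian_complex) simp
    show "(\<lambda>z. (cmod (F z))\<^sup>2 * exp (- \<alpha> * (cmod z)\<^sup>2)) \<in> borel_measurable lborel"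
      using borel_measurable_continuous_onI[OF hc] by measurable
    have "(cmod (F z))\<^sup>2 * exp (- \<alpha> * (cmod z)\<^sup>2) \<le> C\<^sup>2 * exp (- (2 * \<epsilon>) * (cmod z)\<^sup>2)" for z
    proof -
      have "(cmod (F z))\<^sup>2 \<le> (C * exp ((s + \<epsilon>) * (cmod z)\<^sup>2))\<^sup>2"
        using C by (intro power_mono) auto
      also have "\<dots> = C\<^sup>2 * exp (2 * ((s + \<epsilon>) * (cmod z)\<^sup>2))"
        by (simp add: power_mult_distrib exp_double)
      finally have "(cmod (F z))\<^sup>2 * exp (- \<alpha> * (cmod z)\<^sup>2) \<le>
          C\<^sup>2 * exp (2 * ((s + \<epsilon>) * (cmod z)\<^sup>2)) * exp (- \<alpha> * (cmod z)\<^sup>2)"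
        by (intro mult_right_mono) auto
      also have "\<dots> = C\<^sup>2 * exp (2 * ((s + \<epsilon>) * (cmod z)\<^sup>2) + - \<alpha> * (cmod z)\<^sup>2)"
        by (simp only: exp_add mult.assoc)
      also have "2 * ((s + \<epsilon>) * (cmod z)\<^sup>2) + - \<alpha> * (cmod z)\<^sup>2 = - (2 * \<epsilon>) * (cmod z)\<^sup>2"
        by (simp add: \<epsilon>_def field_simps)
      finally show ?thesis .
    qed
    thus "AE z in lborel. norm ((cmod (F z))\<^sup>2 * exp (- \<alpha> * (cmod z)\<^sup>2)) \<le>
        norm (C\<^sup>2 * exp (- (2 * \<epsilon>) * (cmod z)\<^sup>2))"
      by simp
  qed
  thus ?thesis
    using assms(1) by (simp add: fock_space_def)
qed

text \<open>The mean value inequality for \<open>F\<^sup>2\<close> compares \<open>|F z|\<^sup>2\<close> with the Fock norm; on the square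
  around \<open>z\<close> the weight is at least \<open>exp(- \<alpha> (|z| + 4)\<^sup>2)\<close>. Replacing
  \<open>|z| + 4\<close> by \<open>|z|\<close> costs the \<open>\<epsilon>\<close>.\<close>
lemma quadratic_type_le_if_fock_space:
  assumes "\<alpha> > 0" "F \<in> fock_space \<alpha>"
  shows "quadratic_type_le (\<alpha> / 2) F"
  unfolding quadratic_type_le_def
proof (intro allI impI)
  fix \<epsilon> :: real assume "0 < \<epsilon>"
  have hol: "F holomorphic_on UNIV"
    and int: "integrable lborel (\<lambda>z::complex. (cmod (F z))\<^sup>2 * exp (- \<alpha> * (cmod z)\<^sup>2))"
    using assms(2) by (auto simp: fock_space_def)
  have hc: "continuous_on UNIV F"
    using hol by (rule holomorphic_on_imp_continuous_on)
  define q where "q = (\<lambda>z::complex. (cmod (F z))\<^sup>2 * exp (- \<alpha> * (cmod z)\<^sup>2))"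
  define M where "M = integral\<^sup>L lborel q"
  have meas: "(\<lambda>(x, y). Complex x y) \<in> borel_measurable (lborel :: (real \<times> real) measure)"
    using continuous_Complex_pair[of UNIV] by (simp add: borel_measurable_continuous_onI)
  have qmeas: "q \<in> borel_measurable borel"
    unfolding q_def using borel_measurable_continuous_onI[OF hc] by measurable
  have q2: "integrable lborel (\<lambda>p. q ((\<lambda>(x, y). Complex x y) p))"
    using int integrable_distr_eq[OF meas qmeas] unfolding q_def[symmetric]
    by (simp flip: lborel_complex_eq_distr)
  have M2: "M = (\<integral>p. q ((\<lambda>(x, y). Complex x y) p) \<partial>lborel)"
    unfolding M_def by (subst lborel_complex_eq_distr, rule integral_distr[OF meas qmeas])
  have "M \<ge> 0" unfolding M_def by (rule Bochner_Integration.integral_nonneg) (simp add: q_def)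
  obtain D where D: "D > 0" "\<And>r. r \<ge> 0 \<Longrightarrow>
      exp (\<alpha> * (r + 4)\<^sup>2) \<le> D * exp ((\<alpha> + 2 * \<epsilon>) * r\<^sup>2)"
    using exp_square_shift[of \<alpha> "2 * \<epsilon>" 4] assms(1) \<open>0 < \<epsilon>\<close> by auto
  have "cmod (F z) \<le> sqrt ((M + 1) * D) * exp ((\<alpha> / 2 + \<epsilon>) * (cmod z)\<^sup>2)" for z
  proof -
    define B where "B = cbox (Re z - 2, Im z - 2) (Re z + 2, Im z + 2)"
    define E where "E = exp (\<alpha> * (cmod z + 4)\<^sup>2)"
    define \<phi> where "\<phi> = (\<lambda>p. cmod (F (Complex (fst p) (snd p))) ^ 2)"
    have c\<phi>: "continuous_on B \<phi>"
      unfolding \<phi>_def Complex_eq by (intro continuous_intros continuous_on_compose2[OF hc]) auto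
    have i\<phi>: "integrable lborel (\<lambda>p. indicator B p *\<^sub>R \<phi> p)"
      by (rule borel_integrable_compact[OF _ c\<phi>]) (simp add: B_def)
    have le: "indicator B p *\<^sub>R \<phi> p \<le> E * q ((\<lambda>(x, y). Complex x y) p)" for p
    proof (cases "p \<in> B")
      case True
      define w where "w = Complex (fst p) (snd p)"
      have "\<bar>Re (w - z)\<bar> \<le> 2" "\<bar>Im (w - z)\<bar> \<le> 2"
        using True by (auto simp: B_def w_def mem_box Basis_prod_def inner_prod_def abs_le_iff algebra_simps)
      hence "cmod (w - z) \<le> 4"
        using cmod_le[of "w - z"] by linarith
      hence "cmod w \<le> cmod z + 4"
        using norm_triangle_ineq[of z "w - z"] by simp
      hence "\<alpha> * (cmod w)\<^sup>2 \<le> \<alpha> * (cmod z + 4)\<^sup>2"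
        using assms(1) by (intro mult_left_mono power_mono) auto
      hence "1 \<le> exp (\<alpha> * (cmod z + 4)\<^sup>2 + - \<alpha> * (cmod w)\<^sup>2)"
        by simp
      also have "\<dots> = E * exp (- \<alpha> * (cmod w)\<^sup>2)"
        unfolding E_def by (rule exp_add)
      finally have "(cmod (F w))\<^sup>2 * 1 \<le> (cmod (F w))\<^sup>2 * (E * exp (- \<alpha> * (cmod w)\<^sup>2))"
        by (intro mult_left_mono) auto
      thus ?thesis
        using True by (simp add: \<phi>_def q_def w_def case_prod_beta mult_ac)
    next
      case False
      thus ?thesis by (simp add: q_def E_def)
    qed
    have "(\<lambda>w. F w ^ 2) holomorphic_on UNIV"
      using hol by (intro holomorphic_intros)
    from square_mean_bound[OF this, of z]
    have "pi * cmod (F z) ^ 2 \<le> integral B \<phi>"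
      by (simp add: B_def \<phi>_def case_prod_unfold norm_power)
    also have "integral B \<phi> = (\<integral>p. indicator B p *\<^sub>R \<phi> p \<partial>lborel)"
      using set_borel_integral_eq_integral(2)[of B \<phi>] i\<phi>
      by (simp add: set_integrable_def set_lebesgue_integral_def)
    also have "\<dots> \<le> (\<integral>p. E * q ((\<lambda>(x, y). Complex x y) p) \<partial>lborel)"
      using i\<phi> q2 le by (intro integral_mono integrable_mult_right) auto
    also have "\<dots> = E * M"
      by (simp add: M2)
    finally have 1: "pi * cmod (F z) ^ 2 \<le> E * M" .
    have "cmod (F z) ^ 2 \<le> pi * cmod (F z) ^ 2"
      using pi_ge_two by (intro mult_le_cancel_right1[THEN iffD2]) auto
    also note 1
    also have "E * M \<le> D * exp ((\<alpha> + 2 * \<epsilon>) * (cmod z)\<^sup>2) * (M + 1)"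
      unfolding E_def using D(1) D(2)[of "cmod z"] \<open>M \<ge> 0\<close> by (intro mult_mono) auto
    also have "\<dots> = (sqrt ((M + 1) * D) * exp ((\<alpha> / 2 + \<epsilon>) * (cmod z)\<^sup>2))\<^sup>2"
      using D(1) \<open>M \<ge> 0\<close> by (simp add: power_mult_distrib algebra_simps flip: exp_double)
    finally show ?thesis
      by (rule power2_le_imp_le) (use D(1) \<open>M \<ge> 0\<close> in auto)
  qed
  thus "\<exists>C>0. \<forall>z. cmod (F z) \<le> C * exp ((\<alpha> / 2 + \<epsilon>) * (cmod z)\<^sup>2)"
    using D(1) \<open>M \<ge> 0\<close> by (intro exI[of _ "sqrt ((M + 1) * D)"]) auto
qed

section \<open>Angles and the Taylor expansion of the squared modulus\<close>

text \<open>By the double angle formula and the mean value theorem: \<open>cos\<close> is at least \<open>sqrt 2 / 2\<close> up to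
  \<open>\<pi>/4\<close>.\<close>
lemma sin_ge_half:
  fixes x :: real
  assumes "0 \<le> x" "x \<le> pi / 2"
  shows "x / 2 \<le> sin x"
proof (cases "x = 0")
  case False
  hence "\<exists>t>0. t < x / 2 \<and> sin (x / 2) - sin 0 = (x / 2 - 0) * cos t"
    using assms by (intro MVT2) (auto intro!: derivative_eq_intros)
  then obtain t where t: "0 < t" "t < x / 2" "sin (x / 2) = x / 2 * cos t"
    by auto
  have c: "sqrt 2 / 2 \<le> cos u" if "0 \<le> u" "u \<le> pi / 4" for u
    using that cos_monotone_0_pi_le[of u "pi / 4"] by (simp add: cos_45)
  have "x / 2 = 2 * (x / 2 * (sqrt 2 / 2)) * (sqrt 2 / 2)"
    by simp
  also have "\<dots> \<le> 2 * (x / 2 * cos t) * cos (x / 2)"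
    using assms t c[of t] by (intro mult_mono mult_left_mono c mult_nonneg_nonneg) 
      (auto intro: order_trans[of 0 "sqrt 2 / 2"])
  also have "\<dots> = sin x"
    using sin_double[of "x / 2"] t(3) by simp
  finally show ?thesis .
qed simp

text \<open>The middle angle is at most \<open>\<pi>/2\<close> since otherwise the largest angle would be obtuse as well.
  Two obtuse angles at \<open>p\<close> and \<open>q\<close> are impossible because \<open>(q - p) \<bullet> (r - p)\<close> and
  \<open>(p - q) \<bullet> (r - q)\<close> add up to \<open>|q - p|\<^sup>2\<close>. Relabelling puts the vertex in question at \<open>p\<close>.\<close>
lemma middle_angle_at_some_vertex:
  assumes "0 < middle_angle a b c"
  obtains p q r where "{p, q, r} = {a, b, c}" "p \<noteq> q" "p \<noteq> r"
    "middle_angle a b c = interior_angle q p r" "middle_angle a b c \<le> pi / 2"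
proof -
  have nc: "\<not> collinear {a, b, c}"
    using assms by (auto simp: middle_angle_def)
  hence ne: "a \<noteq> b" "a \<noteq> c" "b \<noteq> c"
    by (auto simp: insert_commute)
  define A B C where "A = interior_angle b a c" and "B = interior_angle a b c" and "C = interior_angle a c b"
  have m: "middle_angle a b c = sort [A, B, C] ! 1"
    using nc by (simp add: middle_angle_def A_def B_def C_def)
  have obtuse: "(q - p) \<bullet> (r - p) < 0" if "interior_angle q p r > pi / 2" for p q r :: complex
  proof -
    let ?x = "((q - p) \<bullet> (r - p)) / (cmod (q - p) * cmod (r - p))"
    have "\<not> 0 \<le> ?x"
    proof
      assume "0 \<le> ?x"
      moreover have "?x \<le> 1"
        using norm_cauchy_schwarz[of "q - p" "r - p"] by (cases "q = p \<or> r = p") (auto simp: divide_simps)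
      ultimately have "arccos ?x \<le> arccos 0"
        by (intro arccos_le_arccos) auto
      thus False
        using that by (simp add: interior_angle_def)
    qed
    thus ?thesis
      by (simp add: zero_le_divide_iff not_le)
  qed
  have two: "False" if "interior_angle q p r > pi / 2" "interior_angle p q r > pi / 2" for p q r :: complex
    using obtuse[OF that(1)] obtuse[OF that(2)] inner_ge_zero[of "q - p"]
    by (simp add: inner_diff_left inner_diff_right inner_commute)
  have sym: "interior_angle p q r = interior_angle r q p" for p q r :: complex
    by (simp add: interior_angle_def inner_commute mult.commute)
  have AB: "\<not> (A > pi / 2 \<and> B > pi / 2)"
    using two[of b a c] by (auto simp: A_def B_def)
  have AC: "\<not> (A > pi / 2 \<and> C > pi / 2)"
    using two[of c a b] sym by (auto simp: A_def C_def)
  have BC: "\<not> (B > pi / 2 \<and> C > pi / 2)"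
    using two[of c b a] sym by (auto simp: B_def C_def)
  have "sort [A, B, C] ! 1 \<le> pi / 2"
    using AB AC BC by (auto simp: insort_key.simps)
  moreover have "sort [A, B, C] ! 1 = A \<or> sort [A, B, C] ! 1 = B \<or> sort [A, B, C] ! 1 = C"
    by auto
  ultimately show ?thesis
    using ne unfolding m[symmetric]
    by (elim disjE) (rule that[of a b c] that[of b a c] that[of c a b]; auto simp: A_def B_def C_def)+
qed

text \<open>With the unit vectors \<open>u\<close>, \<open>v\<close> in the directions of \<open>d\<close>, \<open>e\<close>, Cramer's rule recovers \<open>g\<close>
  from the real parts of \<open>g u\<close> and \<open>g v\<close>; the determinant \<open>Im (u cnj v)\<close> is \<open>\<plusminus> sin \<phi>\<close>.\<close>
lemma norm_le_two_directions:
  fixes g d e :: complex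
  assumes "d \<noteq> 0" "e \<noteq> 0"
    and d: "\<bar>Re (g * d)\<bar> \<le> K * cmod d" and e: "\<bar>Re (g * e)\<bar> \<le> K * cmod e"
    and \<phi>: "\<phi> = arccos ((d \<bullet> e) / (cmod d * cmod e))" "0 < \<phi>" "\<phi> \<le> pi / 2"
  shows "cmod g \<le> 4 * K / \<phi>"
proof -
  define u v where "u = sgn d" and "v = sgn e"
  have nuv: "cmod u = 1" "cmod v = 1"
    using assms by (auto simp: u_def v_def norm_sgn)
  have gu: "\<bar>Re (g * u)\<bar> \<le> K"
  proof -
    have "Re (g * u) = Re (g * d) / cmod d"
      by (simp add: u_def sgn_div_norm scaleR_conv_of_real field_simps)
    thus ?thesis using d assms(1) by (simp add: divide_le_eq)
  qed
  have gv: "\<bar>Re (g * v)\<bar> \<le> K"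
  proof -
    have "Re (g * v) = Re (g * e) / cmod e"
      by (simp add: v_def sgn_div_norm scaleR_conv_of_real field_simps)
    thus ?thesis using e assms(2) by (simp add: divide_le_eq)
  qed
  have inner: "(d \<bullet> e) / (cmod d * cmod e) = Re (u * cnj v)"
    by (simp add: u_def v_def sgn_div_norm inner_complex_def field_simps)
  have bd: "\<bar>Re (u * cnj v)\<bar> \<le> 1"
    using abs_Re_le_cmod[of "u * cnj v"] nuv by (simp add: norm_mult)
  hence cos: "cos \<phi> = Re (u * cnj v)"
    using \<phi>(1) inner by (simp add: cos_arccos_abs)
  have "(Re (u * cnj v))\<^sup>2 + (Im (u * cnj v))\<^sup>2 = 1"
    using nuv by (simp only: norm_mult complex_mod_cnj mult_1 power_one flip: cmod_power2)
  hence "(sin \<phi>)\<^sup>2 = (Im (u * cnj v))\<^sup>2"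
    using cos sin_cos_squared_add[of \<phi>] by simp
  moreover have "0 \<le> sin \<phi>"
    using \<phi> by (intro sin_ge_zero) auto
  ultimately have sin: "sin \<phi> = \<bar>Im (u * cnj v)\<bar>"
    by (metis abs_of_nonneg power2_eq_iff abs_minus_cancel)
  have "\<i> * (g * of_real (Im (u * cnj v))) = of_real (Re (g * u)) * cnj v - of_real (Re (g * v)) * cnj u"
    by (simp add: complex_eq_iff algebra_simps)
  hence "cmod g * \<bar>Im (u * cnj v)\<bar> = cmod (of_real (Re (g * u)) * cnj v - of_real (Re (g * v)) * cnj u)"
    by (metis norm_mult norm_ii mult_1 norm_of_real)
  also have "\<dots> \<le> \<bar>Re (g * u)\<bar> + \<bar>Re (g * v)\<bar>"
    using norm_triangle_ineq4[of "of_real (Re (g * u)) * cnj v" "of_real (Re (g * v)) * cnj u"] nuv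
    by (simp only: norm_mult norm_of_real complex_mod_cnj mult_1_right)
  also have "\<dots> \<le> 2 * K"
    using gu gv by simp
  finally have "cmod g * sin \<phi> \<le> 2 * K"
    by (simp add: sin)
  moreover have "cmod g * (\<phi> / 2) \<le> cmod g * sin \<phi>"
    using \<phi> by (intro mult_left_mono sin_ge_half) auto
  ultimately show ?thesis
    using \<phi>(2) by (simp add: field_simps)
qed

text \<open>First order Taylor expansion of \<open>|F|\<^sup>2\<close>. Writing \<open>F q = F p + \<Delta>\<close>, where
  \<open>\<Delta> = F' p * (q - p) + R\<close>, the error is \<open>|\<Delta>|\<^sup>2 + 2 Re (cnj (F p) R)\<close>, and \<open>\<Delta>\<close> and \<open>R\<close> are of
  first and second order in \<open>q - p\<close>.\<close>
lemma norm_square_expansion: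
  assumes hol: "F holomorphic_on UNIV" and S: "convex S" "p \<in> S" "q \<in> S"
    and M: "\<And>w. w \<in> S \<Longrightarrow> cmod (F w) \<le> M" "\<And>w. w \<in> S \<Longrightarrow> cmod (deriv F w) \<le> M"
      "\<And>w. w \<in> S \<Longrightarrow> cmod (deriv (deriv F) w) \<le> M"
  shows "\<bar>(cmod (F q))\<^sup>2 - (cmod (F p))\<^sup>2 - 2 * Re (deriv F p * cnj (F p) * (q - p))\<bar>
    \<le> 3 * M\<^sup>2 * (cmod (q - p))\<^sup>2"
proof -
  have hol': "deriv F holomorphic_on UNIV"
    using hol by (intro holomorphic_deriv) auto
  have d: "(F has_field_derivative deriv F w) (at w within S)" for w
    using holomorphic_derivI[OF hol open_UNIV] by (auto intro: DERIV_subset)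
  have d': "(deriv F has_field_derivative deriv (deriv F) w) (at w within S)" for w
    using holomorphic_derivI[OF hol' open_UNIV] by (auto intro: DERIV_subset)
  have M0: "0 \<le> M" using M(1)[OF S(2)] norm_ge_zero order_trans by blast
  define \<Delta> R where "\<Delta> = F q - F p" and "R = F q - F p - deriv F p * (q - p)"
  have "cmod \<Delta> \<le> M * cmod (q - p)"
    unfolding \<Delta>_def using S by (intro field_differentiable_bound[OF S(1) d M(2)]) auto
  hence "(cmod \<Delta>)\<^sup>2 \<le> M\<^sup>2 * (cmod (q - p))\<^sup>2"
    unfolding power_mult_distrib[symmetric] by (intro power_mono) auto
  moreover have "cmod R \<le> M * (cmod (q - p))\<^sup>2"
  proof -
    have "cmod ((\<lambda>i. (deriv ^^ i) F) 0 q - (\<Sum>i\<le>1. (\<lambda>i. (deriv ^^ i) F) i p * (q - p) ^ i / fact i))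
        \<le> M * cmod (q - p) ^ Suc 1 / fact 1"
      by (rule complex_Taylor[OF S(1) _ _ S(2,3)])
         (use d d' M in \<open>auto simp: le_Suc_eq\<close>)
    thus ?thesis by (simp add: R_def power2_eq_square algebra_simps)
  qed
  hence "cmod (F p) * cmod R \<le> M * (M * (cmod (q - p))\<^sup>2)"
    using M(1)[OF S(2)] M0 by (intro mult_mono) auto
  hence "\<bar>Re (cnj (F p) * R)\<bar> \<le> M * (M * (cmod (q - p))\<^sup>2)"
    using abs_Re_le_cmod[of "cnj (F p) * R"] by (simp add: norm_mult)
  moreover have "(cmod (F q))\<^sup>2 - (cmod (F p))\<^sup>2 - 2 * Re (deriv F p * cnj (F p) * (q - p))
      = (cmod \<Delta>)\<^sup>2 + 2 * Re (cnj (F p) * R)"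
    unfolding cmod_power2 \<Delta>_def R_def by (simp add: algebra_simps power2_eq_square)
  moreover have "3 * M\<^sup>2 * (cmod (q - p))\<^sup>2 =
      M\<^sup>2 * (cmod (q - p))\<^sup>2 + 2 * (M * (M * (cmod (q - p))\<^sup>2))"
    by (simp add: power2_eq_square)
  ultimately show ?thesis
    using zero_le_power2[of "cmod \<Delta>"] by linarith
qed

section \<open>The Wronskian near a triangle of common moduli\<close>

definition wronskian :: "(complex \<Rightarrow> complex) \<Rightarrow> (complex \<Rightarrow> complex) \<Rightarrow> complex \<Rightarrow> complex" where
  "wronskian F H z = deriv F z * H z - F z * deriv H z"

lemma wronskian_holomorphic:
  assumes "F holomorphic_on UNIV" "H holomorphic_on UNIV"
  shows "wronskian F H holomorphic_on UNIV"
  unfolding wronskian_def[abs_def] using assms by (intro holomorphic_intros) auto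

lemma quadratic_type_le_wronskian:
  assumes "F holomorphic_on UNIV" "H holomorphic_on UNIV" "0 \<le> s"
    and "quadratic_type_le s F" "quadratic_type_le s H"
  shows "quadratic_type_le (2 * s) (wronskian F H)"
  unfolding wronskian_def[abs_def] mult_2
  using assms by (intro quadratic_type_le_diff quadratic_type_le_mult quadratic_type_le_deriv)

text \<open>Since \<open>|F| = |H|\<close> at all three vertices, comparing the two Taylor expansions shows that
  \<open>Re (g * (w - p))\<close> is quadratically small for both other vertices \<open>w\<close>, where \<open>g\<close> is the
  Wirtinger derivative of \<open>|F|\<^sup>2 - |H|\<^sup>2\<close> at \<open>p\<close>. The two directions enclose the angle at \<open>p\<close>, so
  \<open>g\<close> itself is small.\<close>
lemma wronskian_product_local_bound:
  assumes hol: "F holomorphic_on UNIV" "H holomorphic_on UNIV"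
    and S: "convex S" "p \<in> S" "q \<in> S" "r \<in> S"
    and M: "\<And>w G. w \<in> S \<Longrightarrow>
        G \<in> {F, deriv F, deriv (deriv F), H, deriv H, deriv (deriv H)} \<Longrightarrow> cmod (G w) \<le> M"
    and eq: "\<And>w. w \<in> {p, q, r} \<Longrightarrow> cmod (F w) = cmod (H w)"
    and D: "cmod (q - p) \<le> D" "cmod (r - p) \<le> D" and ne: "p \<noteq> q" "p \<noteq> r"
    and angle: "0 < interior_angle q p r" "interior_angle q p r \<le> pi / 2"
  shows "cmod (F p * wronskian F H p) \<le> 12 * M ^ 3 * D / interior_angle q p r"
proof -
  define g where "g = deriv F p * cnj (F p) - deriv H p * cnj (H p)"
  have M0: "0 \<le> M" using M[OF S(2), of F] norm_ge_zero[of "F p"] by (simp del: norm_ge_zero)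
  have dir: "\<bar>Re (g * (w - p))\<bar> \<le> (3 * M\<^sup>2 * D) * cmod (w - p)"
    if w: "w \<in> {q, r}" for w
  proof -
    have wS: "w \<in> S" and wD: "cmod (w - p) \<le> D"
      using w S D by auto
    have F: "\<bar>(cmod (F w))\<^sup>2 - (cmod (F p))\<^sup>2 - 2 * Re (deriv F p * cnj (F p) * (w - p))\<bar>
        \<le> 3 * M\<^sup>2 * (cmod (w - p))\<^sup>2"
      by (rule norm_square_expansion[OF hol(1) S(1,2) wS]) (use M in auto)
    have H: "\<bar>(cmod (H w))\<^sup>2 - (cmod (H p))\<^sup>2 - 2 * Re (deriv H p * cnj (H p) * (w - p))\<bar>
        \<le> 3 * M\<^sup>2 * (cmod (w - p))\<^sup>2"
      by (rule norm_square_expansion[OF hol(2) S(1,2) wS]) (use M in auto)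
    have "Re (g * (w - p)) =
        Re (deriv F p * cnj (F p) * (w - p)) - Re (deriv H p * cnj (H p) * (w - p))"
      unfolding g_def left_diff_distrib by simp
    moreover have "(cmod (F w))\<^sup>2 = (cmod (H w))\<^sup>2" "(cmod (F p))\<^sup>2 = (cmod (H p))\<^sup>2"
      using eq w by auto
    ultimately have "\<bar>Re (g * (w - p))\<bar> \<le> 3 * M\<^sup>2 * (cmod (w - p))\<^sup>2"
      using F H by linarith
    also have "\<dots> \<le> (3 * M\<^sup>2 * D) * cmod (w - p)"
      using wD unfolding power2_eq_square[of "cmod (w - p)"] mult.assoc
      by (intro mult_left_mono mult_right_mono) auto
    finally show ?thesis .
  qed
  have "cmod g \<le> 4 * (3 * M\<^sup>2 * D) / interior_angle q p r"
    by (rule norm_le_two_directions[of "q - p" "r - p"])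
       (use ne angle dir in \<open>auto simp: interior_angle_def\<close>)
  hence "cmod (H p) * cmod g \<le> M * (4 * (3 * M\<^sup>2 * D) / interior_angle q p r)"
    using M[OF S(2), of H] M0 by (intro mult_mono) auto
  also have "\<dots> = 12 * M ^ 3 * D / interior_angle q p r"
    by (simp add: power2_eq_square power3_eq_cube)
  finally have "cmod (H p * g) \<le> 12 * M ^ 3 * D / interior_angle q p r"
    by (simp add: norm_mult)
  moreover have "cnj (F p) * wronskian F H p = H p * g"
  proof -
    have "F p * cnj (F p) = H p * cnj (H p)"
      using eq[of p] by (metis complex_norm_square insertI1)
    thus ?thesis
      unfolding wronskian_def g_def by algebra
  qed
  ultimately show ?thesis
    by (metis complex_mod_cnj norm_mult)
qed

section \<open>Boundedness on the Liouville set\<close>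

lemma quadratic_type_le_cball_finite:
  assumes "finite \<G>" "\<And>G. G \<in> \<G> \<Longrightarrow> quadratic_type_le s G" "0 \<le> s" "0 < \<epsilon>" "0 \<le> K"
  shows "\<exists>C>0. \<forall>G\<in>\<G>. \<forall>z. \<forall>w\<in>cball z K. cmod (G w) \<le> C * exp ((s + \<epsilon>) * (cmod z)\<^sup>2)"
  using assms(1,2)
proof (induction \<G> rule: finite_induct)
  case empty
  show ?case by (auto intro: exI[of _ 1])
next
  case (insert G \<G>)
  obtain C D where C: "C > 0" "\<And>G z w. \<lbrakk>G \<in> \<G>; w \<in> cball z K\<rbrakk> \<Longrightarrow>
        cmod (G w) \<le> C * exp ((s + \<epsilon>) * (cmod z)\<^sup>2)"
    and D: "D > 0" "\<And>z w. w \<in> cball z K \<Longrightarrow> cmod (G w) \<le> D * exp ((s + \<epsilon>) * (cmod z)\<^sup>2)"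
    using insert quadratic_type_le_cball[of s G \<epsilon> K] assms(3-5) by (metis insertCI)
  have "C * exp t \<le> (C + D) * exp t" "D * exp t \<le> (C + D) * exp t" for t :: real
    using C(1) D(1) by (simp_all add: mult_right_mono)
  hence "cmod (G' w) \<le> (C + D) * exp ((s + \<epsilon>) * (cmod z)\<^sup>2)"
    if "G' \<in> insert G \<G>" "w \<in> cball z K" for G' z w
    using that C(2)[of G' w z] D(2)[of w z]
    by (cases "G' = G") (fastforce intro: order_trans)+
  thus ?case
    using C(1) D(1) by (intro exI[of _ "C + D"]) auto
qed

text \<open>Displacements of size \<open>exp(- \<gamma> |l|\<^sup>2)\<close> outweigh the growth of the derivative when the type is
  below \<open>\<gamma>\<close>, so a bound at the displaced points transfers to the points \<open>l\<close>.\<close>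
lemma bounded_variation_at_close_points:
  assumes "G holomorphic_on UNIV" "quadratic_type_le s G" "0 \<le> s" "s < \<gamma>" "0 \<le> \<kappa>"
  obtains B where "\<And>l w. cmod (w - l) \<le> \<kappa> * exp (- \<gamma> * (cmod l)\<^sup>2) \<Longrightarrow> cmod (G l - G w) \<le> B"
proof -
  obtain C where C: "C > 0" "\<And>z w. w \<in> cball z \<kappa> \<Longrightarrow>
      cmod (deriv G w) \<le> C * exp ((s + (\<gamma> - s)) * (cmod z)\<^sup>2)"
    using quadratic_type_le_cball[OF quadratic_type_le_deriv[OF assms(2,3,1)] assms(3), of "\<gamma> - s" \<kappa>]
      assms(4,5) by auto
  have "cmod (G l - G w) \<le> C * \<kappa>" if w: "cmod (w - l) \<le> \<kappa> * exp (- \<gamma> * (cmod l)\<^sup>2)" for l w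
  proof -
    have "\<kappa> * exp (- \<gamma> * (cmod l)\<^sup>2) \<le> \<kappa> * 1"
      using assms(3-5) by (intro mult_left_mono) auto
    hence mem: "w \<in> cball l \<kappa>"
      using w by (simp add: dist_norm norm_minus_commute)
    have "cmod (G l - G w) \<le> C * exp (\<gamma> * (cmod l)\<^sup>2) * cmod (l - w)"
    proof (rule field_differentiable_bound[of "cball l \<kappa>"])
      show "(G has_field_derivative deriv G x) (at x within cball l \<kappa>)" for x
        using holomorphic_derivI[OF assms(1) open_UNIV] by (auto intro: DERIV_subset)
    qed (use C mem assms(5) in auto)
    also have "\<dots> \<le> C * exp (\<gamma> * (cmod l)\<^sup>2) * (\<kappa> * exp (- \<gamma> * (cmod l)\<^sup>2))"
      using w C(1) by (intro mult_left_mono) (auto simp: norm_minus_commute)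
    also have "\<dots> = C * \<kappa>"
      by (simp add: exp_minus)
    finally show ?thesis .
  qed
  thus ?thesis by (rule that)
qed

lemma inverse_angle_bound:
  assumes "cmod l * exp (- \<beta> * (cmod l)\<^sup>2) / \<phi> \<le> L" "0 < \<phi>" "1 \<le> cmod l"
  shows "1 / \<phi> \<le> L * exp (\<beta> * (cmod l)\<^sup>2)"
proof -
  have "1 * exp (- \<beta> * (cmod l)\<^sup>2) / \<phi> \<le> cmod l * exp (- \<beta> * (cmod l)\<^sup>2) / \<phi>"
    using assms by (intro divide_right_mono mult_right_mono) auto
  hence "exp (- \<beta> * (cmod l)\<^sup>2) / \<phi> \<le> L"
    using assms(1) by simp
  thus ?thesis
    using assms(2) by (simp add: exp_minus field_simps)
qed

text \<open>Near the origin boundedness is clear by continuity, so only \<open>|l| \<ge> 1\<close> matters; there the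
  factor \<open>|l|\<close> in the angle condition can be dropped. The local bound at the vertex \<open>p\<close> of the
  middle angle then involves \<open>exp((2 \<alpha> - \<gamma> + \<beta>) |l|\<^sup>2)\<close>, whose exponent is nonpositive, and the step
  from \<open>p\<close> to \<open>l\<close> costs a constant.\<close>
lemma wronskian_product_bounded:
  assumes \<alpha>: "0 < \<alpha>" and \<gamma>: "2 * \<alpha> < \<gamma>"
    and F: "F holomorphic_on UNIV" "quadratic_type_le (\<alpha> / 2) F"
    and H: "H holomorphic_on UNIV" "quadratic_type_le (\<alpha> / 2) H"
    and \<kappa>: "0 < \<kappa>" "\<And>l w. \<lbrakk>l \<in> \<Lambda>; w \<in> {a l, b l, c l}\<rbrakk> \<Longrightarrow> cmod (w - l) \<le> \<kappa> * exp (- \<gamma> * (cmod l)\<^sup>2)"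
    and angle: "angle_condition \<alpha> \<gamma> \<Lambda> a b c"
    and eq: "\<And>l w. \<lbrakk>l \<in> \<Lambda>; w \<in> {a l, b l, c l}\<rbrakk> \<Longrightarrow> cmod (F w) = cmod (H w)"
  shows "bounded ((\<lambda>z. F z * wronskian F H z) ` \<Lambda>)"
proof -
  let ?E = "\<lambda>z. F z * wronskian F H z"
  obtain \<beta> L where \<beta>: "\<beta> < \<gamma> - 2 * \<alpha>" and L: "L > 0"
    and pos: "\<And>l. l \<in> \<Lambda> \<Longrightarrow> 0 < middle_angle (a l) (b l) (c l)"
    and quot: "\<And>l. l \<in> \<Lambda> \<Longrightarrow>
      cmod l * exp (- \<beta> * (cmod l)\<^sup>2) / middle_angle (a l) (b l) (c l) \<le> L"
    using angle unfolding angle_condition_def by blast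
  have holE: "?E holomorphic_on UNIV"
    by (intro holomorphic_intros F wronskian_holomorphic H)
  have typeE: "quadratic_type_le (\<alpha> / 2 + 2 * (\<alpha> / 2)) ?E"
    using \<alpha> by (intro quadratic_type_le_mult quadratic_type_le_wronskian F H) auto
  obtain B where B: "\<And>l w. cmod (w - l) \<le> \<kappa> * exp (- \<gamma> * (cmod l)\<^sup>2) \<Longrightarrow> cmod (?E l - ?E w) \<le> B"
    using bounded_variation_at_close_points[OF holE typeE, of \<gamma> \<kappa>] \<alpha> \<gamma> \<kappa>(1) by auto
  let ?\<G> = "{F, deriv F, deriv (deriv F), H, deriv H, deriv (deriv H)}"
  have "quadratic_type_le (\<alpha> / 2) G" if "G \<in> ?\<G>" for G
    using that F H \<alpha> by (auto intro!: quadratic_type_le_deriv holomorphic_deriv)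
  \<comment> \<open>The loss \<open>\<alpha>/6\<close> is chosen so that the cube of this bound grows like \<open>exp(2 \<alpha> |z|\<^sup>2)\<close>, which
    is what \<open>\<gamma> - \<beta> > 2 \<alpha>\<close> can compensate.\<close>
  hence "\<exists>C>0. \<forall>G\<in>?\<G>. \<forall>z. \<forall>w\<in>cball z \<kappa>. cmod (G w) \<le> C * exp ((\<alpha> / 2 + \<alpha> / 6) * (cmod z)\<^sup>2)"
    using \<alpha> \<kappa>(1) by (intro quadratic_type_le_cball_finite) auto
  then obtain C where C: "C > 0" "\<And>G z w. \<lbrakk>G \<in> ?\<G>; w \<in> cball z \<kappa>\<rbrakk> \<Longrightarrow>
      cmod (G w) \<le> C * exp ((\<alpha> / 2 + \<alpha> / 6) * (cmod z)\<^sup>2)"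
    by blast
  have large: "cmod (?E l) \<le> B + 24 * C ^ 3 * \<kappa> * L" if l: "l \<in> \<Lambda>" "1 \<le> cmod l" for l
  proof -
    define \<delta> where "\<delta> = \<kappa> * exp (- \<gamma> * (cmod l)\<^sup>2)"
    define M where "M = C * exp ((\<alpha> / 2 + \<alpha> / 6) * (cmod l)\<^sup>2)"
    define \<phi> where "\<phi> = middle_angle (a l) (b l) (c l)"
    have \<phi>0: "0 < \<phi>"
      using pos[OF l(1)] by (simp add: \<phi>_def)
    obtain p q r where pqr: "{p, q, r} = {a l, b l, c l}" "p \<noteq> q" "p \<noteq> r"
      "\<phi> = interior_angle q p r" "\<phi> \<le> pi / 2"
      using middle_angle_at_some_vertex[OF pos[OF l(1)]] unfolding \<phi>_def by metis
    have close: "cmod (w - l) \<le> \<delta>" if "w \<in> {p, q, r}" for w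
      using \<kappa>(2)[OF l(1)] that unfolding pqr(1) \<delta>_def by blast
    have "\<delta> \<le> \<kappa> * 1"
      unfolding \<delta>_def using \<alpha> \<gamma> \<kappa>(1) by (intro mult_left_mono) auto
    hence mem: "w \<in> cball l \<kappa>" if "w \<in> {p, q, r}" for w
      using close[OF that] by (simp add: dist_norm norm_minus_commute)
    have diam: "cmod (w - p) \<le> 2 * \<delta>" if "w \<in> {p, q, r}" for w
      using close[OF that] close[of p] norm_triangle_ineq4[of "w - l" "p - l"] by simp
    have "cmod (?E p) \<le> 12 * M ^ 3 * (2 * \<delta>) / interior_angle q p r"
    proof (rule wronskian_product_local_bound[OF F(1) H(1) convex_cball[of l \<kappa>]])
      show "cmod (G w) \<le> M" if "w \<in> cball l \<kappa>" "G \<in> ?\<G>" for w G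
        unfolding M_def using C(2)[OF that(2,1)] .
      show "cmod (F w) = cmod (H w)" if "w \<in> {p, q, r}" for w
        using eq[OF l(1)] that unfolding pqr(1) .
    qed (use mem diam pqr(2-5) \<phi>0 in auto)
    also have "\<dots> = 24 * M ^ 3 * \<delta> * (1 / \<phi>)"
      by (simp add: pqr(4))
    also have "\<dots> \<le> 24 * M ^ 3 * \<delta> * (L * exp (\<beta> * (cmod l)\<^sup>2))"
      using inverse_angle_bound[OF quot[OF l(1)] pos[OF l(1)] l(2)] C(1) \<kappa>(1)
      by (intro mult_left_mono) (auto simp: \<phi>_def M_def \<delta>_def)
    also have "\<dots> = 24 * C ^ 3 * \<kappa> * L * exp ((2 * \<alpha> - \<gamma> + \<beta>) * (cmod l)\<^sup>2)"
    proof -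
      have "exp ((\<alpha> / 2 + \<alpha> / 6) * (cmod l)\<^sup>2) ^ 3 * exp (- \<gamma> * (cmod l)\<^sup>2) * exp (\<beta> * (cmod l)\<^sup>2)
          = exp ((2 * \<alpha> - \<gamma> + \<beta>) * (cmod l)\<^sup>2)"
        by (simp add: algebra_simps flip: exp_of_nat_mult exp_add)
      thus ?thesis
        by (simp add: M_def \<delta>_def power_mult_distrib mult_ac)
    qed
    also have "\<dots> \<le> 24 * C ^ 3 * \<kappa> * L * 1"
      using \<beta> C(1) \<kappa>(1) L by (intro mult_left_mono) (auto simp: mult_nonpos_nonneg)
    finally have "cmod (?E p) \<le> 24 * C ^ 3 * \<kappa> * L"
      by simp
    moreover have "cmod (?E l - ?E p) \<le> B"
      using B close[of p] by (simp add: \<delta>_def)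
    ultimately show ?thesis
      using norm_triangle_sub[of "?E l" "?E p"] by simp
  qed
  have "bounded (?E ` cball 0 1)"
    using holomorphic_on_imp_continuous_on[OF holE]
    by (intro compact_imp_bounded compact_continuous_image) (auto intro: continuous_on_subset)
  moreover have "bounded (?E ` {l \<in> \<Lambda>. 1 \<le> cmod l})"
    using large by (intro boundedI[of _ "B + 24 * C ^ 3 * \<kappa> * L"]) auto
  ultimately have "bounded (?E ` cball 0 1 \<union> ?E ` {l \<in> \<Lambda>. 1 \<le> cmod l})"
    by simp
  moreover have "\<Lambda> \<subseteq> cball 0 1 \<union> {l \<in> \<Lambda>. 1 \<le> cmod l}"
    by auto
  hence "?E ` \<Lambda> \<subseteq> ?E ` cball 0 1 \<union> ?E ` {l \<in> \<Lambda>. 1 \<le> cmod l}"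
    unfolding image_Un[symmetric] by (rule image_mono)
  ultimately show ?thesis
    by (rule bounded_subset)
qed

section \<open>From bounded products to proportional functions\<close>

text \<open>If \<open>F W = c \<noteq> 0\<close>, then \<open>F\<close> and \<open>W\<close> have no zeros, hence \<open>H\<close> is a constant multiple of
  \<open>F\<close> and \<open>W = 0\<close>, which is absurd. So \<open>F W = 0\<close>; a point with \<open>W \<noteq> 0\<close> would have a neighbourhood
  on which \<open>F\<close> vanishes, and there \<open>W\<close> vanishes too.\<close>
lemma wronskian_eq_0_if_products_constant:
  assumes hol: "F holomorphic_on UNIV" "H holomorphic_on UNIV"
    and FW: "(\<lambda>z. F z * wronskian F H z) constant_on UNIV"
    and HW: "(\<lambda>z. H z * wronskian H F z) constant_on UNIV"
  shows "wronskian F H z = 0"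
proof -
  obtain c d where c: "\<And>z. F z * wronskian F H z = c" and d: "\<And>z. H z * wronskian H F z = d"
    using FW HW by (auto simp: constant_on_def)
  have anti: "wronskian H F z = - wronskian F H z" for z
    by (simp add: wronskian_def mult.commute)
  have "c = 0"
  proof (rule ccontr)
    assume "c \<noteq> 0"
    have nz: "F z \<noteq> 0" "wronskian F H z \<noteq> 0" for z
      using c[of z] \<open>c \<noteq> 0\<close> by auto
    define k where "k = - (d / c)"
    have "H z = k * F z" for z
      unfolding k_def using c[of z] d[of z] nz[of z] by (simp add: anti flip: c[of z] d[of z])
    hence "H = (\<lambda>z. k * F z)" by auto
    moreover have "F field_differentiable at z" for z
      using hol(1) by (simp add: holomorphic_on_def)
    ultimately have "wronskian F H z = 0"
      by (simp add: wronskian_def deriv_cmult)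
    thus False using nz by simp
  qed
  show ?thesis
  proof (rule ccontr)
    assume W: "wronskian F H z \<noteq> 0"
    have "continuous_on UNIV (wronskian F H)"
      by (intro holomorphic_on_imp_continuous_on wronskian_holomorphic hol)
    hence "open {w. wronskian F H w \<noteq> 0}"
      by (intro open_Collect_neq continuous_intros)
    hence "\<forall>\<^sub>F w in nhds z. wronskian F H w \<noteq> 0"
      using W by (auto simp: eventually_nhds)
    hence "\<forall>\<^sub>F w in nhds z. F w = 0"
      by eventually_elim (use c \<open>c = 0\<close> in auto)
    hence "F z = 0" "deriv F z = deriv (\<lambda>_. 0) z"
      by (rule eventually_nhds_x_imp_x, rule deriv_cong_ev) simp
    thus False using W by (simp add: wronskian_def)
  qed
qed

text \<open>\<open>H / F\<close> has derivative zero near \<open>z0\<close>; the identity theorem extends the proportionality to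
  the whole plane, across the zeros of \<open>F\<close>.\<close>
lemma proportional_if_wronskian_eq_0:
  assumes hol: "F holomorphic_on UNIV" "H holomorphic_on UNIV"
    and W: "\<And>z. wronskian F H z = 0" and nz: "F z0 \<noteq> 0"
  obtains \<tau> where "\<And>z. H z = \<tau> * F z"
proof -
  have "continuous_on UNIV F"
    using hol(1) by (rule holomorphic_on_imp_continuous_on)
  hence "open {z. F z \<noteq> 0}"
    by (intro open_Collect_neq continuous_intros)
  then obtain e where e: "e > 0" "ball z0 e \<subseteq> {z. F z \<noteq> 0}"
    using nz by (auto elim: openE)
  have nzb: "F z \<noteq> 0" if "z \<in> ball z0 e" for z
    using e(2) that by blast
  have "\<exists>\<tau>. \<forall>z\<in>ball z0 e. H z / F z = \<tau>"
  proof (rule has_field_derivative_zero_constant)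
    show "((\<lambda>z. H z / F z) has_field_derivative 0) (at z within ball z0 e)" if z: "z \<in> ball z0 e" for z
    proof -
      have "((\<lambda>z. H z / F z) has_field_derivative (deriv H z * F z - H z * deriv F z) / (F z * F z))
          (at z within ball z0 e)"
        by (intro DERIV_divide nzb[OF z] holomorphic_derivI[OF hol(1) open_UNIV UNIV_I]
          holomorphic_derivI[OF hol(2) open_UNIV UNIV_I])
      moreover have "deriv H z * F z - H z * deriv F z = 0"
        using W[of z] by (simp add: wronskian_def algebra_simps)
      ultimately show ?thesis by simp
    qed
  qed simp
  then obtain \<tau> where \<tau>: "\<And>z. z \<in> ball z0 e \<Longrightarrow> H z / F z = \<tau>"
    by blast
  have "H z = \<tau> * F z" for z
  proof (rule analytic_continuation_open[of "ball z0 e" UNIV H "\<lambda>z. \<tau> * F z"])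
    show "H z = \<tau> * F z" if "z \<in> ball z0 e" for z
      using \<tau>[OF that] nzb[OF that] by (auto simp: field_simps)
  qed (use e(1) hol in \<open>auto intro!: holomorphic_intros\<close>)
  thus ?thesis by (rule that)
qed

section \<open>The uniqueness theorem\<close>

lemma le_exp_square:
  fixes x \<epsilon> :: real
  assumes "0 < \<epsilon>"
  shows "x \<le> (1 + 1 / \<epsilon>) * exp (\<epsilon> * x\<^sup>2)"
proof -
  have "x \<le> 1 + x\<^sup>2"
    using zero_le_power2[of "x - 1 / 2"] by (simp add: power2_eq_square algebra_simps)
  also have "\<dots> \<le> (1 + 1 / \<epsilon>) * (1 + \<epsilon> * x\<^sup>2)"
    using assms by (simp add: field_simps)
  also have "\<dots> \<le> (1 + 1 / \<epsilon>) * exp (\<epsilon> * x\<^sup>2)"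
    using assms by (intro mult_left_mono exp_ge_add_one_self) auto
  finally show ?thesis .
qed

text \<open>On the empty set every function is bounded, in particular the identity, which belongs to
  every Fock space.\<close>
lemma liouville_set_fock_nonempty:
  assumes "0 < \<alpha>" "liouville_set \<Lambda> (fock_space \<alpha>)"
  shows "\<Lambda> \<noteq> {}"
proof
  assume "\<Lambda> = {}"
  have "quadratic_type_le 0 (\<lambda>z. z)"
    unfolding quadratic_type_le_def
  proof (intro allI impI)
    fix \<epsilon> :: real assume "0 < \<epsilon>"
    thus "\<exists>C>0. \<forall>z. cmod z \<le> C * exp ((0 + \<epsilon>) * (cmod z)\<^sup>2)"
      using le_exp_square[of \<epsilon>] by (intro exI[of _ "1 + 1 / \<epsilon>"]) (auto intro: add_pos_pos)
  qed
  hence "(\<lambda>z. z) \<in> fock_space \<alpha>"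
    using assms(1) by (intro fock_space_if_quadratic_type_le[of _ 0]) auto
  hence "(\<lambda>z::complex. z) constant_on UNIV"
    using assms(2) \<open>\<Lambda> = {}\<close> by (auto simp: liouville_set_def)
  hence "(0::complex) = 1"
    unfolding constant_on_def by (metis UNIV_I)
  thus False by simp
qed

text \<open>A function vanishing at points close to \<open>\<Lambda>\<close> is bounded on \<open>\<Lambda>\<close>, hence constant by the Liouville
  property, and the constant is its value at one of its zeros.\<close>
lemma fock_zero_if_zero_at_close_points:
  assumes \<alpha>: "0 < \<alpha>" and \<gamma>: "2 * \<alpha> < \<gamma>" and \<Lambda>: "liouville_set \<Lambda> (fock_space (4 * \<alpha>))"
    and G: "G \<in> fock_space \<alpha>"
    and close: "0 \<le> \<kappa>" "\<And>l. l \<in> \<Lambda> \<Longrightarrow> cmod (a l - l) \<le> \<kappa> * exp (- \<gamma> * (cmod l)\<^sup>2)"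
    and zero: "\<And>l. l \<in> \<Lambda> \<Longrightarrow> G (a l) = 0"
  shows "G z = 0"
proof -
  have hol: "G holomorphic_on UNIV"
    using G by (simp add: fock_space_def)
  have type: "quadratic_type_le (\<alpha> / 2) G"
    by (rule quadratic_type_le_if_fock_space[OF \<alpha> G])
  obtain B where B: "\<And>l w. cmod (w - l) \<le> \<kappa> * exp (- \<gamma> * (cmod l)\<^sup>2) \<Longrightarrow> cmod (G l - G w) \<le> B"
    using bounded_variation_at_close_points[OF hol type, of \<gamma> \<kappa>] \<alpha> \<gamma> close(1) by auto
  have "cmod (G l) \<le> B" if "l \<in> \<Lambda>" for l
    using B[OF close(2)[OF that]] zero[OF that] by simp
  hence "bounded (G ` \<Lambda>)"
    by (intro boundedI[of _ B]) auto
  moreover have "G \<in> fock_space (4 * \<alpha>)"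
    using \<alpha> by (intro fock_space_if_quadratic_type_le[OF hol type]) auto
  ultimately obtain k where k: "\<And>z. G z = k"
    using \<Lambda> by (auto simp: liouville_set_def constant_on_def)
  obtain l where "l \<in> \<Lambda>"
    using liouville_set_fock_nonempty[OF _ \<Lambda>] \<alpha> by auto
  thus ?thesis
    using zero k by metis
qed

text \<open>With the angles bounded below, any admissible exponent \<open>\<beta>\<close> works; the midpoint of the range is
  used.\<close>
lemma angle_condition_if_uniformly_noncollinear:
  assumes "2 * \<alpha> < \<gamma>" "uniformly_noncollinear \<Lambda> a b c"
  shows "angle_condition \<alpha> \<gamma> \<Lambda> a b c"
proof -
  obtain \<theta> where \<theta>: "0 < \<theta>" "\<And>l. l \<in> \<Lambda> \<Longrightarrow> \<theta> \<le> middle_angle (a l) (b l) (c l)"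
    using assms(2) by (auto simp: uniformly_noncollinear_def)
  define \<beta> where "\<beta> = (\<gamma> - 2 * \<alpha>) / 2"
  have \<beta>: "0 < \<beta>" "\<beta> < \<gamma> - 2 * \<alpha>"
    using assms(1) by (auto simp: \<beta>_def)
  have "cmod l * exp (- \<beta> * (cmod l)\<^sup>2) / middle_angle (a l) (b l) (c l) \<le> (1 + 1 / \<beta>) / \<theta>"
    if "l \<in> \<Lambda>" for l
  proof (rule frac_le)
    show "cmod l * exp (- \<beta> * (cmod l)\<^sup>2) \<le> 1 + 1 / \<beta>"
      using le_exp_square[OF \<beta>(1), of "cmod l"] by (simp add: exp_minus divide_simps)
  qed (use \<theta> that \<beta> in auto)
  moreover have "0 < (1 + 1 / \<beta>) / \<theta>"
    using \<beta> \<theta> by (intro divide_pos_pos add_pos_pos) auto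
  moreover have "0 < middle_angle (a l) (b l) (c l)" if "l \<in> \<Lambda>" for l
    using \<theta> that by (meson less_le_trans)
  ultimately show ?thesis
    unfolding angle_condition_def using \<beta> by blast
qed

theorem theorem2p4:
  fixes \<alpha> \<gamma> :: real and \<Lambda> :: "complex set"
    and f :: "complex \<Rightarrow> real" and a b c :: "complex \<Rightarrow> complex"
  assumes "\<alpha> > 0"
    and "liouville_set \<Lambda> (fock_space (4 * \<alpha>))"
    and "\<gamma> > 2 * \<alpha>"
    and "\<And>z. f z = exp (- \<gamma> * (cmod z)\<^sup>2)"
    and "f_close f \<Lambda> a" and "f_close f \<Lambda> b" and "f_close f \<Lambda> c"
  shows "(angle_condition \<alpha> \<gamma> \<Lambda> a b c \<longrightarrow>
            phase_retrieval_uniqueness_set (a ` \<Lambda> \<union> b ` \<Lambda> \<union> c ` \<Lambda>) (fock_space \<alpha>)) \<and>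
         (uniformly_noncollinear \<Lambda> a b c \<longrightarrow> angle_condition \<alpha> \<gamma> \<Lambda> a b c)"
proof (intro conjI impI)
  show "angle_condition \<alpha> \<gamma> \<Lambda> a b c" if "uniformly_noncollinear \<Lambda> a b c"
    using assms(3) that by (rule angle_condition_if_uniformly_noncollinear)
next
  assume angle: "angle_condition \<alpha> \<gamma> \<Lambda> a b c"
  let ?U = "a ` \<Lambda> \<union> b ` \<Lambda> \<union> c ` \<Lambda>"
  obtain \<kappa>1 \<kappa>2 \<kappa>3 where k: "0 < \<kappa>1" "0 < \<kappa>2" "0 < \<kappa>3"
    and "\<forall>l\<in>\<Lambda>. cmod (a l - l) \<le> \<kappa>1 * f l" "\<forall>l\<in>\<Lambda>. cmod (b l - l) \<le> \<kappa>2 * f l"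
      "\<forall>l\<in>\<Lambda>. cmod (c l - l) \<le> \<kappa>3 * f l"
    using assms(5-7) unfolding f_close_def by blast
  define \<kappa> where "\<kappa> = \<kappa>1 + \<kappa>2 + \<kappa>3"
  have \<kappa>0: "0 < \<kappa>" using k by (simp add: \<kappa>_def)
  have \<kappa>: "cmod (w - l) \<le> \<kappa> * exp (- \<gamma> * (cmod l)\<^sup>2)" if "l \<in> \<Lambda>" "w \<in> {a l, b l, c l}" for l w
  proof -
    have "cmod (w - l) \<le> \<kappa>1 * f l \<or> cmod (w - l) \<le> \<kappa>2 * f l \<or> cmod (w - l) \<le> \<kappa>3 * f l"
      using that \<open>\<forall>l\<in>\<Lambda>. cmod (a l - l) \<le> \<kappa>1 * f l\<close> \<open>\<forall>l\<in>\<Lambda>. cmod (b l - l) \<le> \<kappa>2 * f l\<close>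
        \<open>\<forall>l\<in>\<Lambda>. cmod (c l - l) \<le> \<kappa>3 * f l\<close> by auto
    moreover have "\<kappa>1 * f l \<le> \<kappa> * f l" "\<kappa>2 * f l \<le> \<kappa> * f l" "\<kappa>3 * f l \<le> \<kappa> * f l"
      using k by (auto simp: \<kappa>_def assms(4))
    ultimately show ?thesis
      by (auto simp: assms(4) intro: order_trans)
  qed
  have zero: "G z = 0" if "G \<in> fock_space \<alpha>" "\<And>u. u \<in> ?U \<Longrightarrow> G u = 0" for G z
    by (rule fock_zero_if_zero_at_close_points[OF assms(1,3,2) that(1), of \<kappa> a])
       (use \<kappa>0 \<kappa> that(2) in auto)
  show "phase_retrieval_uniqueness_set ?U (fock_space \<alpha>)"
    unfolding phase_retrieval_uniqueness_set_def
  proof (intro ballI impI)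
    fix F H assume F: "F \<in> fock_space \<alpha>" and H: "H \<in> fock_space \<alpha>"
      and eq: "\<forall>u\<in>?U. cmod (F u) = cmod (H u)"
    have hol: "F holomorphic_on UNIV" "H holomorphic_on UNIV"
      using F H by (auto simp: fock_space_def)
    \<comment> \<open>Stated for arbitrary \<open>P\<close> and \<open>Q\<close> since it is applied to \<open>F, H\<close> and to \<open>H, F\<close>.\<close>
    have const: "(\<lambda>z. P z * wronskian P Q z) constant_on UNIV"
      if P: "P \<in> fock_space \<alpha>" and Q: "Q \<in> fock_space \<alpha>"
        and PQ: "\<And>u. u \<in> ?U \<Longrightarrow> cmod (P u) = cmod (Q u)" for P Q
    proof -
      have holP: "P holomorphic_on UNIV" and holQ: "Q holomorphic_on UNIV"
        using P Q by (auto simp: fock_space_def)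
      note type = P[THEN quadratic_type_le_if_fock_space[OF assms(1)]]
        Q[THEN quadratic_type_le_if_fock_space[OF assms(1)]]
      have "(\<lambda>z. P z * wronskian P Q z) \<in> fock_space (4 * \<alpha>)"
      proof (rule fock_space_if_quadratic_type_le)
        show "(\<lambda>z. P z * wronskian P Q z) holomorphic_on UNIV"
          by (intro holomorphic_intros holP wronskian_holomorphic holQ)
        show "quadratic_type_le (\<alpha> / 2 + 2 * (\<alpha> / 2)) (\<lambda>z. P z * wronskian P Q z)"
          using assms(1) by (intro quadratic_type_le_mult quadratic_type_le_wronskian holP holQ type) auto
      qed (use assms(1) in auto)
      moreover have "bounded ((\<lambda>z. P z * wronskian P Q z) ` \<Lambda>)"
        by (rule wronskian_product_bounded[OF assms(1,3) holP type(1) holQ type(2) \<kappa>0 \<kappa> angle])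
           (use PQ in auto)
      ultimately show ?thesis
        using assms(2) by (simp add: liouville_set_def)
    qed
    have W: "wronskian F H z = 0" for z
      by (rule wronskian_eq_0_if_products_constant[OF hol const[OF F H] const[OF H F]])
         (use eq in auto)
    show "\<exists>\<tau>. cmod \<tau> = 1 \<and> (\<forall>z. H z = \<tau> * F z)"
    proof (cases "\<forall>u\<in>?U. F u = 0")
      case True
      have "F z = 0" "H z = 0" for z
        using zero[OF F, of z] zero[OF H, of z] True eq by auto
      thus ?thesis by (intro exI[of _ 1]) auto
    next
      case False
      then obtain u where u: "u \<in> ?U" "F u \<noteq> 0" by blast
      obtain \<tau> where \<tau>: "\<And>z. H z = \<tau> * F z"
        using proportional_if_wronskian_eq_0[OF hol W u(2)] by blast
      have "cmod (F u) = cmod \<tau> * cmod (F u)"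
        using eq u(1) \<tau>[of u] by (metis norm_mult)
      thus ?thesis
        using \<tau> u(2) by auto
    qed
  qed
qed

end
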